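(* Let $n\ge1$, $h\ge2$ and $i_1,\dots,i_h,j_1,\dots,j_h\in\{1,\dots,n\}$. In $\mathbf U(gl(n))$ the column Capelli bitableau satisfies both $$\left[\begin{array}{c}i_1\\ i_2\\ \vdots\\ i_h\end{array}\right|\left.\begin{array}{c}j_1\\ j_2\\ \vdots\\ j_h\end{array}\right]=(-1)^{h-1}e_{i_1,j_1}\left[\begin{array}{c}i_2\\ \vdots\\ i_h\end{array}\right|\left.\begin{array}{c}j_2\\ \vdots\\ j_h\end{array}\right]+(-1)^{h-2}\sum_{k=2}^h\delta_{i_k,j_1}\left[\begin{array}{c}i_1\\ i_2\\ \vdots\\ i_{k-1}\\ i_{k+1}\\ \vdots\\ i_h\end{array}\right|\left.\begin{array}{c}j_k\\ j_2\\ \vdots\\ j_{k-1}\\ j_{k+1}\\ \vdots\\ j_h\end{array}\right]$$ and $$\left[\begin{array}{c}i_1\\ i_2\\ \vdots\\ i_h\end{array}\right|\left.\begin{array}{c}j_1\\ j_2\\ \vdots\\ j_h\end{array}\right]=(-1)^{h-1}\left[\begin{array}{c}i_1\\ \vdots\\ i_{h-1}\end{array}\right|\left.\begin{array}{c}j_1\\ \vdots\\ j_{h-1}\end{array}\right]e_{i_h,j_h}+(-1)^{h-2}\sum_{k=1}^{h-1}\delta_{i_h,j_k}\left[\begin{array}{c}i_1\\ \vdots\\ i_{k-1}\\ i_{k+1}\\ \vdots\\ i_{h-1}\\ i_k\end{array}\right|\left.\begin{array}{c}j_1\\ \vdots\\ j_{k-1}\\ j_{k+1}\\ \vdots\\ j_{h-1}\\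 j_h\end{array}\right].$$ (In the $k$-th summand of the first formula the row pairs are $(i_1,j_k)$ followed by $(i_r,j_r)$ for $r\in\{2,\dots,h\}\setminus\{k\}$; in the $k$-th summand of the second they are $(i_r,j_r)$ for $r\in\{1,\dots,h-1\}\setminus\{k\}$ followed by $(i_k,j_h)$.)
   Context: **Virtual variables.** Let $A_0=\{\alpha_1,\dots,\alpha_{m_0}\}$, $A_1=\{\beta_1,\dots,\beta_{m_1}\}$, $L=\{1,\dots,n\}$ be disjoint sets of symbols ($m_0,m_1$ sufficiently large), with parities $|\alpha_s|=0$, $|\beta_t|=|i|=1$ in $\mathbb Z_2$. $gl(m_0|m_1+n)$ is the complex Lie superalgebra with basis $e_{a,b}$, $a,b\in A_0\cup A_1\cup L$, $|e_{a,b}|=|a|+|b|$, and superbracket $[e_{a,b},e_{c,d}]=\delta_{bc}e_{a,d}-(-1)^{(|a|+|b|)(|c|+|d|)}\delta_{ad}e_{c,b}$; $gl(n)$ is its Lie subalgebra spanned by $e_{ij}=e_{i,j}$, $i,j\in L$. A product $e_{a_m,b_m}\cdots e_{a_1,b_1}$ in $\mathbf U(gl(m_0|m_1+n))$ is irregular if there are $i\le m$ and $\gamma\in A_0\cup A_1$ with $\#\{j\le i: b_j=\gamma\}>\#\{j<i: a_j=\gamma\}$. $\mathbf{Irr}$ is the left ideal generated by irregular products. It is known that $\mathbf U(gl(n))\cap\mathbf{Irr}=0$ and that $Virt(m_0+m_1,n)=\mathbf U(gl(n))\oplus\mathbf{Irr}$ is a subalgebra in which $\mathbf{Irr}$ is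 a two-sided ideal; $\mathfrak p:Virt(m_0+m_1,n)\to\mathbf U(gl(n))$ is the projection with kernel $\mathbf{Irr}$. **Column Capelli bitableaux.** For $i_1,\dots,i_h,j_1,\dots,j_h\in\{1,\dots,n\}$ and distinct $\alpha_1,\dots,\alpha_h\in A_0$, $$\left[\begin{array}{c}i_1\\ \vdots\\ i_h\end{array}\right|\left.\begin{array}{c}j_1\\ \vdots\\ j_h\end{array}\right]=\mathfrak p\big(e_{i_1,\alpha_1}\cdots e_{i_h,\alpha_h}\,e_{\alpha_1,j_1}\cdots e_{\alpha_h,j_h}\big)\in\mathbf U(gl(n))$$ (the argument of $\mathfrak p$ lies in $Virt(m_0+m_1,n)$, and the result does not depend on the choice of the $\alpha$'s). *)

theory Defs
  imports Complex_Main "HOL-Library.Poly_Mapping"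
begin

section \<open>The free associative algebra\<close>

datatype 'g free_word = Word (letters: "'g list")

instantiation free_word :: (type) monoid_add
begin

definition zero_free_word :: "'a free_word" where
  "0 = Word []"

definition plus_free_word :: "'a free_word \<Rightarrow> 'a free_word \<Rightarrow> 'a free_word" where
  "v + w = Word (letters v @ letters w)"

instance
  by standard (simp_all add: zero_free_word_def plus_free_word_def)

end

text \<open>Since addition of words is concatenation, the convolution product makes
  \<open>'g free_alg\<close> the free associative unital complex algebra on \<open>'g\<close>.\<close>

type_synonym 'g free_alg = "'g free_word \<Rightarrow>\<^sub>0 complex"

definition word :: "'g list \<Rightarrow> 'g free_alg" where
  "word w = Poly_Mapping.single (Word w) 1"

inductive_set two_sided_ideal_gen :: "'r::ring_1 set \<Rightarrow> 'r set" for R :: "'r set" where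
  zero: "0 \<in> two_sided_ideal_gen R"
| add: "\<lbrakk>x \<in> two_sided_ideal_gen R; y \<in> two_sided_ideal_gen R\<rbrakk> \<Longrightarrow> x + y \<in> two_sided_ideal_gen R"
| gen: "r \<in> R \<Longrightarrow> x * r * y \<in> two_sided_ideal_gen R"

inductive_set left_ideal_gen :: "'r::ring_1 set \<Rightarrow> 'r set" for R :: "'r set" where
  zero: "0 \<in> left_ideal_gen R"
| add: "\<lbrakk>x \<in> left_ideal_gen R; y \<in> left_ideal_gen R\<rbrakk> \<Longrightarrow> x + y \<in> left_ideal_gen R"
| gen: "r \<in> R \<Longrightarrow> x * r \<in> left_ideal_gen R"

lemma two_sided_ideal_gen_uminus:
  "x \<in> two_sided_ideal_gen R \<Longrightarrow> - x \<in> two_sided_ideal_gen R"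
proof (induction rule: two_sided_ideal_gen.induct)
  case zero
  show ?case by (simp add: two_sided_ideal_gen.zero)
next
  case (add x y)
  then have "(- x) + (- y) \<in> two_sided_ideal_gen R" by (intro two_sided_ideal_gen.add)
  then show ?case by (simp add: add.commute)
next
  case (gen r x y)
  then have "(- x) * r * y \<in> two_sided_ideal_gen R" by (rule two_sided_ideal_gen.gen)
  then show ?case by simp
qed

lemma two_sided_ideal_gen_diff:
  "\<lbrakk>x \<in> two_sided_ideal_gen R; y \<in> two_sided_ideal_gen R\<rbrakk> \<Longrightarrow> x - y \<in> two_sided_ideal_gen R"
  using two_sided_ideal_gen.add[OF _ two_sided_ideal_gen_uminus, of x R y] by simp

lemma two_sided_ideal_gen_mult_left:
  "x \<in> two_sided_ideal_gen R \<Longrightarrow> z * x \<in> two_sided_ideal_gen R"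
proof (induction rule: two_sided_ideal_gen.induct)
  case (gen r x y)
  then show ?case using two_sided_ideal_gen.gen[of r R "z * x" y] by (simp add: mult.assoc)
qed (auto simp: distrib_left intro: two_sided_ideal_gen.zero two_sided_ideal_gen.add)

lemma two_sided_ideal_gen_mult_right:
  "x \<in> two_sided_ideal_gen R \<Longrightarrow> x * z \<in> two_sided_ideal_gen R"
proof (induction rule: two_sided_ideal_gen.induct)
  case (gen r x y)
  then show ?case using two_sided_ideal_gen.gen[of r R x "y * z"] by (simp add: mult.assoc)
qed (auto simp: distrib_right intro: two_sided_ideal_gen.zero two_sided_ideal_gen.add)


section \<open>Enveloping algebras of general linear Lie superalgebras\<close>

class symbol =
  fixes parity :: "'a \<Rightarrow> nat"
  assumes parity_less_2: "parity a < 2"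

text \<open>The pair \<open>(a, b)\<close> stands for the basis element \<open>e\<^sub>a\<^sub>b\<close>
  of the Lie superalgebra.\<close>

definition e_parity :: "'s::symbol \<times> 's \<Rightarrow> nat" where
  "e_parity p = parity (fst p) + parity (snd p)"

definition superbracket :: "'s::symbol \<times> 's \<Rightarrow> 's \<times> 's \<Rightarrow> ('s \<times> 's) free_alg" where
  "superbracket p q = (case (p, q) of ((a, b), (c, d)) \<Rightarrow>
     of_bool (b = c) * word [(a, d)]
     - (-1) ^ (e_parity (a, b) * e_parity (c, d)) * of_bool (a = d) * word [(c, b)])"

definition uea_relations :: "('s::symbol \<times> 's) free_alg set" where
  "uea_relations = {word [p, q] - (-1) ^ (e_parity p * e_parity q) * word [q, p]
     - superbracket p q | p q. True}"

definition uea_ideal :: "('s::symbol \<times> 's) free_alg set" where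
  "uea_ideal = two_sided_ideal_gen uea_relations"

lemma uea_ideal_zero: "0 \<in> uea_ideal"
  and uea_ideal_add: "\<lbrakk>x \<in> uea_ideal; y \<in> uea_ideal\<rbrakk> \<Longrightarrow> x + y \<in> uea_ideal"
  and uea_ideal_uminus: "x \<in> uea_ideal \<Longrightarrow> - x \<in> uea_ideal"
  and uea_ideal_diff: "\<lbrakk>x \<in> uea_ideal; y \<in> uea_ideal\<rbrakk> \<Longrightarrow> x - y \<in> uea_ideal"
  and uea_ideal_mult_left: "x \<in> uea_ideal \<Longrightarrow> z * x \<in> uea_ideal"
  and uea_ideal_mult_right: "x \<in> uea_ideal \<Longrightarrow> x * z \<in> uea_ideal"
  unfolding uea_ideal_def
  by (rule two_sided_ideal_gen.zero two_sided_ideal_gen.add two_sided_ideal_gen_uminus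
      two_sided_ideal_gen_diff two_sided_ideal_gen_mult_left two_sided_ideal_gen_mult_right; assumption)+

text \<open>\<open>'s uea\<close> is the universal enveloping algebra of the general linear Lie
  superalgebra whose basis is indexed by pairs of symbols of type \<open>'s\<close>.\<close>

quotient_type (overloaded) 's uea = "('s::symbol \<times> 's) free_alg" / "\<lambda>x y. x - y \<in> uea_ideal"
  morphisms rep_uea uea_of
proof (rule equivpI)
  show "reflp (\<lambda>x y::('s \<times> 's) free_alg. x - y \<in> uea_ideal)"
    by (simp add: reflp_def uea_ideal_zero)
  show "symp (\<lambda>x y::('s \<times> 's) free_alg. x - y \<in> uea_ideal)"
    using uea_ideal_uminus by (fastforce simp: symp_def)
  show "transp (\<lambda>x y::('s \<times> 's) free_alg. x - y \<in> uea_ideal)"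
    using uea_ideal_add by (fastforce simp: transp_def)
qed

lemma lookup_mult_0:
  fixes x y :: "'g free_alg"
  shows "Poly_Mapping.lookup (x * y) 0 = Poly_Mapping.lookup x 0 * Poly_Mapping.lookup y 0"
proof -
  have *: "(0 = l + q) = (q = 0 \<and> l = 0)" for l q :: "'g free_word"
    by (cases l; cases q) (auto simp: zero_free_word_def plus_free_word_def)
  have "(\<Sum>q. Poly_Mapping.lookup y q when 0 = l + q) = (Poly_Mapping.lookup y 0 when l = 0)" for l
    by (cases "l = 0") (simp_all add: *)
  then show ?thesis
    by (simp add: lookup_mult mult_when)
qed

lemma lookup_uea_ideal_0:
  fixes x :: "('s::symbol \<times> 's) free_alg"
  assumes "x \<in> uea_ideal"
  shows "Poly_Mapping.lookup x 0 = 0"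
proof -
  have "Poly_Mapping.lookup (word (g # w)) 0 = 0" for g :: "'s \<times> 's" and w
    by (simp add: word_def lookup_single zero_free_word_def)
  then have "Poly_Mapping.lookup r 0 = 0" if "r \<in> uea_relations" for r :: "('s \<times> 's) free_alg"
    using that
    by (auto simp: uea_relations_def superbracket_def lookup_minus lookup_mult_0)
  with assms show ?thesis
    unfolding uea_ideal_def
    by (induction rule: two_sided_ideal_gen.induct) (simp_all add: lookup_add lookup_mult_0)
qed

instantiation uea :: (symbol) ring_1
begin

lift_definition zero_uea :: "'a uea" is 0 .

lift_definition one_uea :: "'a uea" is 1 .

lift_definition plus_uea :: "'a uea \<Rightarrow> 'a uea \<Rightarrow> 'a uea" is "(+)"
  using uea_ideal_add by (fastforce simp: algebra_simps)

lift_definition uminus_uea :: "'a uea \<Rightarrow> 'a uea" is uminus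
  using uea_ideal_uminus by fastforce

lift_definition minus_uea :: "'a uea \<Rightarrow> 'a uea \<Rightarrow> 'a uea" is "(-)"
  using uea_ideal_diff by (fastforce simp: algebra_simps)

lift_definition times_uea :: "'a uea \<Rightarrow> 'a uea \<Rightarrow> 'a uea" is "(*)"
proof -
  fix x x' y y' :: "('a \<times> 'a) free_alg"
  assume "x - x' \<in> uea_ideal" "y - y' \<in> uea_ideal"
  then have "(x - x') * y + x' * (y - y') \<in> uea_ideal"
    by (intro uea_ideal_add uea_ideal_mult_left uea_ideal_mult_right)
  then show "x * y - x' * y' \<in> uea_ideal" by (simp add: algebra_simps)
qed

instance
proof
  show "(0::'a uea) \<noteq> 1"
    by transfer (auto dest: lookup_uea_ideal_0)
qed (transfer; simp add: algebra_simps uea_ideal_zero)+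

end

definition e_gen :: "'s::symbol \<Rightarrow> 's \<Rightarrow> 's uea" where
  "e_gen a b = uea_of (word [(a, b)])"


section \<open>Virtual and proper symbols\<close>

text \<open>\<open>'n proper uea\<close> is \<open>U(gl(n))\<close> and \<open>('a, 'b, 'n) vsymbol uea\<close> is
  \<open>U(gl(m\<^sub>0|m\<^sub>1+n))\<close>, for finite types \<open>'a\<close>, \<open>'b\<close>, \<open>'n\<close> of
  cardinality \<open>m\<^sub>0\<close>, \<open>m\<^sub>1\<close>, \<open>n\<close> enumerating the symbols in \<open>A\<^sub>0\<close>, \<open>A\<^sub>1\<close>, \<open>L\<close>.\<close>

datatype 'n proper = Proper 'n

datatype ('a, 'b, 'n) vsymbol = Alpha 'a | Beta 'b | Place "'n proper"

instantiation proper :: (type) symbol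
begin

definition parity_proper :: "'a proper \<Rightarrow> nat" where
  "parity_proper i = 1"

instance by standard (simp add: parity_proper_def)

end

instantiation vsymbol :: (type, type, type) symbol
begin

definition parity_vsymbol :: "('a, 'b, 'c) vsymbol \<Rightarrow> nat" where
  "parity_vsymbol s = (case s of Alpha _ \<Rightarrow> 0 | Beta _ \<Rightarrow> 1 | Place i \<Rightarrow> parity i)"

instance by standard (simp add: parity_vsymbol_def parity_less_2 split: vsymbol.split)

end

definition relabel :: "('s \<Rightarrow> 't) \<Rightarrow> ('s \<times> 's) free_alg \<Rightarrow> ('t \<times> 't) free_alg" where
  "relabel f x = (\<Sum>w\<in>Poly_Mapping.keys x.
     Poly_Mapping.single (Word (map (map_prod f f) (letters w))) (Poly_Mapping.lookup x w))"

lemma relabel_superset: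
  assumes "finite A" "Poly_Mapping.keys x \<subseteq> A"
  shows "relabel f x = (\<Sum>w\<in>A.
    Poly_Mapping.single (Word (map (map_prod f f) (letters w))) (Poly_Mapping.lookup x w))"
  unfolding relabel_def
  by (rule sum.mono_neutral_left) (use assms in \<open>auto simp: in_keys_iff\<close>)

lemma relabel_add: "relabel f (x + y) = relabel f x + relabel f y"
proof -
  let ?A = "Poly_Mapping.keys x \<union> Poly_Mapping.keys y"
  have "Poly_Mapping.keys (x + y) \<subseteq> ?A" by (rule Poly_Mapping.keys_add)
  then show ?thesis
    by (simp add: relabel_superset[of ?A] lookup_add single_add sum.distrib)
qed

lemma relabel_single:
  "relabel f (Poly_Mapping.single (Word w) c) = Poly_Mapping.single (Word (map (map_prod f f) w)) c"
  by (simp add: relabel_def)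

lemma relabel_zero: "relabel f 0 = 0"
  by (simp add: relabel_def)

lemma relabel_uminus: "relabel f (- x) = - relabel f x"
  using relabel_add[of f x "- x"] by (simp add: relabel_zero add_eq_0_iff)

lemma relabel_diff: "relabel f (x - y) = relabel f x - relabel f y"
  using relabel_add[of f x "- y"] by (simp add: relabel_uminus)

lemma relabel_word: "relabel f (word w) = word (map (map_prod f f) w)"
  by (simp add: word_def relabel_single)

lemma relabel_one: "relabel f 1 = 1"
  using relabel_word[of f "[]"]
  by (simp add: word_def flip: zero_free_word_def)

lemma free_alg_induct [case_names single add]:
  fixes x :: "'g free_alg"
  assumes "\<And>w c. P (Poly_Mapping.single (Word w) c)"
    and "\<And>x y. P x \<Longrightarrow> P y \<Longrightarrow> P (x + y)"
  shows "P x"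
proof (induction x rule: update_induct)
  case const
  show ?case using assms(1)[of undefined 0] by simp
next
  case (update f a b)
  have "Poly_Mapping.update a b f = f + Poly_Mapping.single a b"
    using update.hyps
    by (intro poly_mapping_eqI) (auto simp: lookup_update lookup_add lookup_single in_keys_iff when_def)
  then show ?case using assms(2)[OF update.IH assms(1)[of "letters a" b]] by simp
qed

lemma relabel_mult: "relabel f (x * y) = relabel f x * relabel f y"
proof (induction x rule: free_alg_induct)
  case (single v c)
  show ?case
  proof (induction y rule: free_alg_induct)
    case (single w d)
    show ?case by (simp add: mult_single relabel_single plus_free_word_def)
  qed (simp add: distrib_left relabel_add)
qed (simp add: distrib_right relabel_add)

lemma relabel_sign: "relabel f ((-1) ^ k) = (-1) ^ k"
  by (induction k) (simp_all add: relabel_one relabel_uminus)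

lemma relabel_of_bool: "relabel f (of_bool P) = of_bool P"
  by (cases P) (simp_all add: relabel_one relabel_zero)

lemma relabel_uea_ideal:
  fixes f :: "'s::symbol \<Rightarrow> 't::symbol"
  assumes f: "inj f" "\<And>a. parity (f a) = parity a" and x: "x \<in> uea_ideal"
  shows "relabel f x \<in> uea_ideal"
proof -
  have ep: "e_parity (map_prod f f p) = e_parity p" for p
    by (simp add: e_parity_def f)
  have sb: "relabel f (superbracket p q) = superbracket (map_prod f f p) (map_prod f f q)" for p q
    by (cases p; cases q) (simp add: superbracket_def e_parity_def relabel_diff relabel_mult
        relabel_sign relabel_of_bool relabel_word inj_eq[OF f(1)] f(2))
  have rel: "relabel f r \<in> uea_relations" if r: "r \<in> uea_relations" for r
  proof -
    obtain p q where "r = word [p, q] - (-1) ^ (e_parity p * e_parity q) * word [q, p]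
        - superbracket p q"
      using r by (auto simp: uea_relations_def)
    then have "relabel f r = word [map_prod f f p, map_prod f f q]
        - (-1) ^ (e_parity (map_prod f f p) * e_parity (map_prod f f q))
          * word [map_prod f f q, map_prod f f p]
        - superbracket (map_prod f f p) (map_prod f f q)"
      by (simp add: relabel_diff relabel_mult relabel_sign relabel_word sb ep)
    then show ?thesis unfolding uea_relations_def by blast
  qed
  show ?thesis
    using x unfolding uea_ideal_def
    by (induction rule: two_sided_ideal_gen.induct)
      (simp_all add: relabel_zero relabel_add relabel_mult rel two_sided_ideal_gen.intros)
qed

text \<open>The homomorphism \<open>U(gl(n)) \<rightarrow> U(gl(m\<^sub>0|m\<^sub>1+n))\<close> induced by the
  inclusion of \<open>gl(n)\<close>.\<close>

lift_definition incl :: "'n proper uea \<Rightarrow> ('a, 'b, 'n) vsymbol uea" is "relabel Place"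
  by (metis relabel_diff relabel_uea_ideal inj_def vsymbol.inject(3) parity_vsymbol_def
      vsymbol.simps(12))

text \<open>A word lists the factors of a product as written, whereas the definition
  numbers them from right to left; hence the reversal: \<open>(a j, b j)\<close> is the \<open>j\<close>-th factor
  from the right.\<close>

definition irregular :: "(('a, 'b, 'n) vsymbol \<times> ('a, 'b, 'n) vsymbol) list \<Rightarrow> bool" where
  "irregular w \<longleftrightarrow> (let a = (\<lambda>j. fst (rev w ! (j - 1))); b = (\<lambda>j. snd (rev w ! (j - 1))) in
     \<exists>i\<in>{1..length w}. \<exists>\<gamma>\<in>range Alpha \<union> range Beta.
       card {j\<in>{1..i}. b j = \<gamma>} > card {j\<in>{1..<i}. a j = \<gamma>})"

definition Irr :: "('a, 'b, 'n) vsymbol uea set" where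
  "Irr = left_ideal_gen {uea_of (word w) | w. irregular w}"

text \<open>The projection is meant on the subalgebra \<open>U(gl(n)) \<oplus> Irr\<close> only and is
  unspecified elsewhere.\<close>

definition capelli_proj :: "('a, 'b, 'n) vsymbol uea \<Rightarrow> 'n proper uea" where
  "capelli_proj y = (THE x. y - incl x \<in> Irr)"

abbreviation E :: "'n \<Rightarrow> 'n \<Rightarrow> 'n proper uea" where
  "E i j \<equiv> e_gen (Proper i) (Proper j)"

text \<open>The first argument lists the auxiliary symbols \<open>\<alpha>\<^sub>1, \<dots>, \<alpha>\<^sub>h\<close>, the other two the
  columns \<open>i\<^sub>1, \<dots>, i\<^sub>h\<close> and \<open>j\<^sub>1, \<dots>, j\<^sub>h\<close>.\<close>

definition column_capelli ::
  "('a, 'b, 'n) vsymbol list \<Rightarrow> 'n list \<Rightarrow> 'n list \<Rightarrow> 'n proper uea" where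
  "column_capelli \<alpha>s is js = capelli_proj
     (prod_list (map2 (\<lambda>i \<alpha>. e_gen (Place (Proper i)) \<alpha>) is \<alpha>s) *
      prod_list (map2 (\<lambda>\<alpha> j. e_gen \<alpha> (Place (Proper j))) \<alpha>s js))"

end

theory Submission
  imports Defs "HOL-Library.Multiset"
begin

text \<open>Let letters \<open>(a, t)\<close>, with \<open>a\<close> any symbol and \<open>t\<close> a place, generate a supercommutative
  algebra. On the products of its elements with \<open>exp (\<Sum>\<^sub>t (t, t))\<close>, the superderivations
  \<open>e\<^sub>a\<^sub>b : (b, t) \<mapsto> (a, t)\<close> represent \<open>gl(m\<^sub>0|m\<^sub>1+n)\<close>. Every irregular product kills
  the vacuum vector \<open>exp (\<Sum>\<^sub>t (t, t))\<close>. On \<open>gl(n)\<close> the linear map \<open>koszul\<close> from polynomials in the proper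
  letters to \<open>U(gl(n))\<close> intertwines this action with left multiplication, so applying an
  element of \<open>U(gl(m\<^sub>0|m\<^sub>1+n))\<close> to the vacuum and then \<open>koszul\<close> (zero on monomials with a virtual letter)
  computes the projection onto \<open>U(gl(n))\<close>. It sends the
  monomial defining a column Capelli bitableau to \<open>(-1)\<^bsup>h(h-1)/2\<^esup> koszul ((i\<^sub>1, j\<^sub>1) \<cdots> (i\<^sub>h, j\<^sub>h))\<close>,
  and the two expansions become the recursion that defines \<open>koszul\<close>, respectively its mirror image for
  right multiplication.\<close>

section \<open>Superderivations on words of letters\<close>

lemma sign_left_commute: "x * ((-1) ^ m * y) = (-1) ^ m * (x * (y :: 'r::ring_1))"
  by (simp add: minus_one_power_iff)

lemma sign_eqI: "even (m + n) \<Longrightarrow> (-1) ^ m = ((-1) ^ n :: 'r::ring_1)"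
  by (auto simp: minus_one_power_iff)

lemma sign_cases: "(-1) ^ m = (1 :: 'r::ring_1) \<or> (-1) ^ m = (-1 :: 'r)"
  by (simp add: minus_one_power_iff)

definition letter_parity :: "'s::symbol \<times> 't \<Rightarrow> nat" where
  "letter_parity x = parity (fst x) + 1"

text \<open>\<open>F\<close> stands for a linear functional, given by its values on words; \<open>der (a, b) F\<close> is its
  composition with the superderivation \<open>(b, t) \<mapsto> (a, t)\<close>. Such composition reverses the order
  of operators. The places are odd, hence the summand 1 in the parity of a letter.\<close>

primrec der :: "'s::symbol \<times> 's \<Rightarrow> (('s \<times> 't) list \<Rightarrow> 'r::ring_1) \<Rightarrow> ('s \<times> 't) list \<Rightarrow> 'r" where
  "der p F [] = 0"
| "der p F (x # w) = of_bool (fst x = snd p) * F ((fst p, snd x) # w)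
     + (-1) ^ (e_parity p * letter_parity x) * der p (\<lambda>v. F (x # v)) w"

text \<open>A superderivation keeps the length of a word, so only the values of \<open>F\<close> on
  words of that length enter. As a congruence rule this lets the recursion of \<open>koszul\<close>,
  which passes \<open>koszul\<close> itself to \<open>der\<close>, terminate by length.\<close>

lemma der_cong [fundef_cong]:
  assumes "p = p'" "w = w'" "\<And>v. length v = length w' \<Longrightarrow> F v = G v"
  shows "der p F w = der p' G w'"
  unfolding assms(1,2) using assms(3)
proof (induction w' arbitrary: F G)
  case (Cons x w)
  have "der p' (\<lambda>v. F (x # v)) w = der p' (\<lambda>v. G (x # v)) w"
    by (rule Cons.IH) (simp add: Cons.prems)
  then show ?case by (simp add: Cons.prems)
qed simp

lemma der_add: "der p (\<lambda>v. F v + G v) w = der p F w + der p G w"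
  by (induction w arbitrary: F G) (simp_all add: algebra_simps)

lemma der_mult_left: "der p (\<lambda>v. c * F v) w = c * der p F w"
  by (induction w arbitrary: F) (simp_all add: algebra_simps sign_left_commute)

lemma der_mult_right: "der p (\<lambda>v. F v * c) w = der p F w * c"
  by (induction w arbitrary: F) (simp_all add: algebra_simps)

lemma der_zero: "der p (\<lambda>v. 0) w = 0"
  using der_mult_left[of p 0 "\<lambda>_. 0" w] by simp

lemma der_minus: "der p (\<lambda>v. - F v) w = - der p F w"
  using der_mult_left[of p "-1" F w] by simp

lemma der_diff: "der p (\<lambda>v. F v - G v) w = der p F w - der p G w"
  using der_add[of p F "\<lambda>v. - G v" w] by (simp add: der_minus)

lemma der_eq_0:
  assumes "\<And>x. x \<in> set v \<Longrightarrow> fst x \<noteq> snd p"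
  shows "der p F v = 0"
  using assms by (induction v arbitrary: F) simp_all

text \<open>Superderivations represent the superbracket. Composition with functionals reverses the
  order, so the left-hand side belongs to the supercommutator of \<open>(a, b)\<close> with
  \<open>(c, d)\<close>. Terms acting twice on the first letter or, by induction, twice on the rest
  give the right-hand side; the mixed terms cancel.\<close>

lemma der_supercommute:
  fixes F :: "('s::symbol \<times> 't) list \<Rightarrow> 'r::ring_1"
  shows "der (c, d) (der (a, b) F) w
     - (-1) ^ (e_parity (a, b) * e_parity (c, d)) * der (a, b) (der (c, d) F) w
   = of_bool (b = c) * der (a, d) F w
     - (-1) ^ (e_parity (a, b) * e_parity (c, d)) * (of_bool (a = d) * der (c, b) F w)"
proof (induction w arbitrary: F)
  case (Cons x w)
  obtain e t where x: "x = (e, t)" by (cases x)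
  define s P Q :: 'r where "s = (-1) ^ (e_parity (a, b) * e_parity (c, d))"
    and "P = (-1) ^ (e_parity (a, b) * letter_parity x)"
    and "Q = (-1) ^ (e_parity (c, d) * letter_parity x)"
  note sPQ_def = this[unfolded x]
  have sPQ: "s = 1 \<or> s = -1" "P = 1 \<or> P = -1" "Q = 1 \<or> Q = -1"
    unfolding sPQ_def by (rule sign_cases)+
  let ?G = "\<lambda>v. F ((e, t) # v)"
  have IH: "der (c, d) (der (a, b) ?G) w = s * der (a, b) (der (c, d) ?G) w
     + of_bool (b = c) * der (a, d) ?G w
     - s * (of_bool (a = d) * der (c, b) ?G w)"
    using Cons.IH[of ?G] unfolding s_def by (simp add: algebra_simps)
  \<comment> \<open>Changing the symbol of the first letter from \<open>d\<close> to
    \<open>c\<close> shifts its parity by that of \<open>(c, d)\<close>, so a superderivation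
    passing over it afterwards picks up the extra sign \<open>s\<close>. This makes the mixed terms
    cancel.\<close>
  have P: "(-1) ^ (e_parity (a, b) * letter_parity (c, t)) = s * P" if "d = e"
    unfolding sPQ_def power_add[symmetric] that
    by (rule sign_eqI) (simp add: e_parity_def letter_parity_def; blast)
  have Q: "(-1) ^ (e_parity (c, d) * letter_parity (a, t)) = s * Q" if "b = e"
    unfolding sPQ_def power_add[symmetric] that
    by (rule sign_eqI) (simp add: e_parity_def letter_parity_def; blast)
  have D: "der (c, d) (der (a, b) F) ((e, t) # w)
    = of_bool (e = d) * (of_bool (c = b) * F ((a, t) # w)
        + s * (P * der (a, b) (\<lambda>v. F ((c, t) # v)) w))
      + Q * (of_bool (e = b) * der (c, d) (\<lambda>v. F ((a, t) # v)) w
        + P * der (c, d) (der (a, b) ?G) w)"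
    using P by (simp add: x sPQ_def der_add der_mult_left mult.assoc)
  have D': "der (a, b) (der (c, d) F) ((e, t) # w)
    = of_bool (e = b) * (of_bool (a = d) * F ((c, t) # w)
        + s * (Q * der (c, d) (\<lambda>v. F ((a, t) # v)) w))
      + P * (of_bool (e = d) * der (a, b) (\<lambda>v. F ((c, t) # v)) w
        + Q * der (a, b) (der (c, d) ?G) w)"
    using Q by (simp add: x sPQ_def der_add der_mult_left mult.assoc)
  have R: "der (g, k) F ((e, t) # w) = of_bool (e = k) * F ((g, t) # w)
    + (-1) ^ (e_parity (g, k) * letter_parity (e, t)) * der (g, k) ?G w" for g k
    by (simp add: x)
  have PQ: "(-1) ^ (e_parity (a, d) * letter_parity (e, t)) = P * Q" if "b = c"
    unfolding sPQ_def power_add[symmetric] that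
    by (rule sign_eqI) (simp add: e_parity_def letter_parity_def; blast)
  have QP: "(-1) ^ (e_parity (c, b) * letter_parity (e, t)) = P * Q" if "a = d"
    unfolding sPQ_def power_add[symmetric] that
    by (rule sign_eqI) (simp add: e_parity_def letter_parity_def; blast)
  have R1: "of_bool (b = c) * der (a, d) F ((e, t) # w) = of_bool (b = c) *
      (of_bool (e = d) * F ((a, t) # w) + P * (Q * der (a, d) ?G w))"
    using R PQ by (simp add: mult.assoc)
  have R2: "of_bool (a = d) * der (c, b) F ((e, t) # w) = of_bool (a = d) *
      (of_bool (e = b) * F ((c, t) # w) + P * (Q * der (c, b) ?G w))"
    using R QP by (simp add: mult.assoc)
  show ?case
    unfolding x s_def[symmetric] D D' R1 R2 IH
    using sPQ by (elim disjE; simp add: algebra_simps)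
qed simp

text \<open>Such an \<open>F\<close> respects the supercommutation relations of the letters in
  degree \<open>n\<close>. The degree is a parameter because for \<open>koszul\<close> the property
  is obtained by induction on it.\<close>

definition supersymmetric :: "nat \<Rightarrow> (('s::symbol \<times> 't) list \<Rightarrow> 'r::ring_1) \<Rightarrow> bool" where
  "supersymmetric n F \<longleftrightarrow> (\<forall>u x y v. length u + length v + 2 = n \<longrightarrow>
     F (u @ x # y # v) = (-1) ^ (letter_parity x * letter_parity y) * F (u @ y # x # v))"

lemma supersymmetricD:
  assumes "supersymmetric n F" "length u + length v + 2 = n"
  shows "F (u @ x # y # v) = (-1) ^ (letter_parity x * letter_parity y) * F (u @ y # x # v)"
  using assms unfolding supersymmetric_def by blast

lemma supersymmetric_Cons:
  fixes F :: "('s::symbol \<times> 't) list \<Rightarrow> 'r::ring_1"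
  assumes "supersymmetric (Suc n) F"
  shows "supersymmetric n (\<lambda>v. F (z # v))"
  unfolding supersymmetric_def
proof (intro allI impI)
  fix u v :: "('s \<times> 't) list" and x y :: "'s \<times> 't" assume "length u + length v + 2 = n"
  then show "F (z # u @ x # y # v)
      = (-1) ^ (letter_parity x * letter_parity y) * F (z # u @ y # x # v)"
    using supersymmetricD[OF assms, of "z # u" v x y] by simp
qed

text \<open>When the superderivation acts on one of the two swapped letters, the parity of that
  letter changes by the parity of \<open>p\<close>. The sign this adds to the swap is the sign for
  passing over the other letter.\<close>

lemma supersymmetric_der:
  fixes F :: "('s::symbol \<times> 't) list \<Rightarrow> 'r::ring_1"
  assumes "supersymmetric n F"
  shows "supersymmetric n (der p F)"
proof -
  have "der p F (u @ x # y # v)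
      = (-1) ^ (letter_parity x * letter_parity y) * der p F (u @ y # x # v)"
    if "length u + length v + 2 = n" for u x y v
    using that assms
  proof (induction u arbitrary: n F)
    case Nil
    note S = supersymmetricD[OF Nil.prems(2), of "[]", simplified]
    have L: "length w = length v \<Longrightarrow> F (x # y # w)
      = (-1) ^ (letter_parity x * letter_parity y) * F (y # x # w)" for w
      using Nil.prems by (intro S) auto
    have "der p (\<lambda>w. F (x # y # w)) v
      = der p (\<lambda>w. (-1) ^ (letter_parity x * letter_parity y) * F (y # x # w)) v"
      by (rule der_cong) (use L in auto)
    then have 1: "der p (\<lambda>w. F (x # y # w)) v
      = (-1) ^ (letter_parity x * letter_parity y) * der p (\<lambda>w. F (y # x # w)) v"
      by (simp only: der_mult_left)
    have 2: "F ((fst p, snd x) # y # v)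
        = (-1) ^ (letter_parity (fst p, snd x) * letter_parity y) * F (y # (fst p, snd x) # v)"
      and 3: "F (x # (fst p, snd y) # v)
        = (-1) ^ (letter_parity x * letter_parity (fst p, snd y)) * F ((fst p, snd y) # x # v)"
      using Nil.prems by (intro S; simp)+
    let ?s = "(-1) ^ (letter_parity x * letter_parity y) :: 'r"
    let ?P = "(-1) ^ (e_parity p * letter_parity x) :: 'r"
    let ?Q = "(-1) ^ (e_parity p * letter_parity y) :: 'r"
    have Q: "(-1) ^ (letter_parity (fst p, snd x) * letter_parity y) = ?s * ?Q" if "fst x = snd p"
      unfolding power_add[symmetric]
      by (rule sign_eqI) (simp add: e_parity_def letter_parity_def that; blast)
    have P: "(-1) ^ (letter_parity x * letter_parity (fst p, snd y)) = ?s * ?P" if "fst y = snd p"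
      unfolding power_add[symmetric]
      by (rule sign_eqI) (simp add: e_parity_def letter_parity_def that; blast)
    have "der p F (x # y # v) = of_bool (fst x = snd p) * (?s * (?Q * F (y # (fst p, snd x) # v)))
        + ?P * (of_bool (fst y = snd p) * (?s * (?P * F ((fst p, snd y) # x # v)))
        + ?Q * (?s * der p (\<lambda>w. F (y # x # w)) v))"
      using P Q by (simp add: 1 2 3 mult.assoc)
    then show ?case
      using sign_cases[where 'r='r, of "letter_parity x * letter_parity y"]
        sign_cases[where 'r='r, of "e_parity p * letter_parity x"]
        sign_cases[where 'r='r, of "e_parity p * letter_parity y"]
      by (elim disjE; simp add: algebra_simps)
  next
    case (Cons z u)
    then obtain m where m: "n = Suc m" "length u + length v + 2 = m" by auto
    have "der p (\<lambda>v. F (z # v)) (u @ x # y # v)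
      = (-1) ^ (letter_parity x * letter_parity y) * der p (\<lambda>v. F (z # v)) (u @ y # x # v)"
      using Cons.prems m by (intro Cons.IH[of m] supersymmetric_Cons) auto
    moreover have "F ((fst p, snd z) # u @ x # y # v)
      = (-1) ^ (letter_parity x * letter_parity y) * F ((fst p, snd z) # u @ y # x # v)"
      using supersymmetricD[OF Cons.prems(2), of "(fst p, snd z) # u" v x y] m by simp
    ultimately show ?case
      using sign_cases[where 'r='r, of "letter_parity x * letter_parity y"]
      by (elim disjE) simp_all
  qed
  then show ?thesis unfolding supersymmetric_def by blast
qed

section \<open>The Koszul map onto the enveloping algebra\<close>

text \<open>The second equation is the intertwining property solved for the longer word: left
  multiplication by a generator corresponds to multiplication by a letter plus a
  superderivation.\<close>

function koszul :: "('n proper \<times> 'n) list \<Rightarrow> 'n proper uea" where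
  "koszul [] = 1"
| "koszul (x # w) = e_gen (fst x) (Proper (snd x)) * koszul w
     - der (fst x, Proper (snd x)) (\<lambda>v. koszul v) w"
  by pat_completeness auto
termination by (relation "measure length") auto

section \<open>Computing modulo the relations of the enveloping algebra\<close>

lemma uea_of_eq_iff: "uea_of x = uea_of y \<longleftrightarrow> x - y \<in> uea_ideal"
  using uea.abs_eq_iff by blast

lemma uea_of_cases:
  obtains y where "x = uea_of y"
  using uea.abs_induct[of "\<lambda>x. \<exists>y. x = uea_of y" x] by blast

lemma uea_of_add: "uea_of (x + y) = uea_of x + uea_of y"
  by (simp add: plus_uea.abs_eq)

lemma uea_of_diff: "uea_of (x - y) = uea_of x - uea_of y"
  by (simp add: minus_uea.abs_eq)

lemma uea_of_mult: "uea_of (x * y) = uea_of x * uea_of y"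
  by (simp add: times_uea.abs_eq)

lemma uea_of_uminus: "uea_of (- x) = - uea_of x"
  by (simp add: uminus_uea.abs_eq)

lemma uea_of_zero: "uea_of 0 = 0"
  by (simp add: zero_uea_def)

lemma uea_of_one: "uea_of 1 = 1"
  by (simp add: one_uea_def)

lemma word_append: "word (u @ v) = word u * word v"
  by (simp add: word_def mult_single plus_free_word_def)

lemma word_Nil: "word [] = 1"
  by (simp add: word_def flip: zero_free_word_def)

lemma uea_of_sign_mult: "uea_of ((-1) ^ k * x) = (-1) ^ k * uea_of x"
  by (simp add: minus_one_power_iff uea_of_uminus)

lemma uea_of_of_bool_mult: "uea_of (of_bool P * x) = of_bool P * uea_of x"
  by (simp add: uea_of_zero)

lemma uea_of_word: "uea_of (word w) = prod_list (map (\<lambda>p. e_gen (fst p) (snd p)) w)"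
proof (induction w)
  case (Cons p w)
  then show ?case
    using word_append[of "[p]" w] by (simp add: uea_of_mult e_gen_def)
qed (simp add: word_Nil uea_of_one)

lemma e_gen_supercommute:
  "e_gen a b * e_gen c d = (-1) ^ (e_parity (a, b) * e_parity (c, d)) * (e_gen c d * e_gen a b)
     + of_bool (b = c) * e_gen a d
     - (-1) ^ (e_parity (a, b) * e_parity (c, d)) * (of_bool (a = d) * e_gen c b)"
proof -
  let ?r = "word [(a, b), (c, d)] - (-1) ^ (e_parity (a, b) * e_parity (c, d)) * word [(c, d), (a, b)]
     - superbracket (a, b) (c, d)"
  have "?r \<in> uea_ideal"
    using two_sided_ideal_gen.gen[of ?r uea_relations 1 1]
    unfolding uea_ideal_def uea_relations_def by force
  then have "uea_of ?r = 0"
    using uea_of_eq_iff[of ?r 0] by (simp add: uea_of_zero)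
  then have "uea_of (word [(a, b), (c, d)])
      = (-1) ^ (e_parity (a, b) * e_parity (c, d)) * uea_of (word [(c, d), (a, b)])
      + uea_of (superbracket (a, b) (c, d))"
    by (simp only: uea_of_diff uea_of_sign_mult diff_eq_eq add_0 add.commute)
  then show ?thesis
    by (simp add: uea_of_word superbracket_def uea_of_diff mult.assoc uea_of_sign_mult
        uea_of_of_bool_mult)
qed

lemma letter_parity_proper [simp]: "letter_parity (x :: 'n proper \<times> 't) = 2"
  by (simp add: letter_parity_def parity_proper_def)

lemma e_parity_proper [simp]: "e_parity (x :: 'n proper \<times> 'n proper) = 2"
  by (simp add: e_parity_def parity_proper_def)

text \<open>Expanding both sides leaves the commutator of two generators, that of the two
  superderivations, and the contraction terms where the first superderivation hits the second
  letter. Both commutators have the same structure constants, and the contractions cancel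
  them.\<close>

lemma koszul_swap_front: "koszul (x # y # v) = koszul (y # x # v)"
proof -
  obtain i j k l where xy: "x = (i, j)" "y = (k, l)" by (cases x; cases y)
  have D: "der p (\<lambda>v. e_gen a (Proper b) * koszul v - der (a, Proper b) koszul v) v
      = e_gen a (Proper b) * der p koszul v - der p (der (a, Proper b) koszul) v" for p a b
    by (simp add: der_diff der_mult_left)
  have e: "e_gen i (Proper j) * (e_gen k (Proper l) * z) = e_gen k (Proper l) * (e_gen i (Proper j) * z)
     + of_bool (Proper j = k) * (e_gen i (Proper l) * z)
     - of_bool (i = Proper l) * (e_gen k (Proper j) * z)" for z
    using arg_cong[OF e_gen_supercommute[of i "Proper j" k "Proper l"], of "\<lambda>t. t * z"]
    by (simp add: algebra_simps)
  have d: "der (k, Proper l) (der (i, Proper j) koszul) v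
     = der (i, Proper j) (der (k, Proper l) koszul) v
     + of_bool (Proper j = k) * der (i, Proper l) koszul v
     - of_bool (i = Proper l) * der (k, Proper j) koszul v"
    using der_supercommute[of k "Proper l" i "Proper j" koszul v] by (simp add: algebra_simps)
  have k: "koszul ((a, b) # (c, d) # v) = e_gen a (Proper b) * (e_gen c (Proper d) * koszul v)
     - e_gen a (Proper b) * der (c, Proper d) koszul v
     - (of_bool (c = Proper b) * (e_gen a (Proper d) * koszul v)
     - of_bool (c = Proper b) * der (a, Proper d) koszul v)
     - (e_gen c (Proper d) * der (a, Proper b) koszul v
       - der (a, Proper b) (der (c, Proper d) koszul) v)" for a b c d
    by (simp only: koszul.simps(2) der.simps D fst_conv snd_conv letter_parity_proper e_parity_proper)
      (simp add: algebra_simps)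
  show ?thesis
    unfolding xy k[of i j k l] k[of k l i j] e d
    by (cases "k = Proper j"; cases "i = Proper l") (simp_all add: algebra_simps)
qed

text \<open>A swap of the first two letters is \<open>koszul_swap_front\<close>. A later swap takes
  place in the words of length \<open>n - 1\<close> to which the recursion reduces, and
  \<open>supersymmetric_der\<close> carries the induction hypothesis through
  \<open>der\<close>.\<close>

lemma supersymmetric_koszul: "supersymmetric n (koszul :: ('a proper \<times> 'a) list \<Rightarrow> _)"
proof (induction n rule: less_induct)
  case (less n)
  have "koszul (u @ x # y # v) = koszul (u @ y # x # v)"
    if "length u + length v + 2 = n" for u v and x y :: "'a proper \<times> 'a"
  proof (cases u)
    case Nil
    then show ?thesis using koszul_swap_front[of x y v] by (simp del: koszul.simps)
  next
    case (Cons z u')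
    have "n - 1 < n" using that by simp
    then have s: "supersymmetric (n - 1) (koszul :: ('a proper \<times> 'a) list \<Rightarrow> _)"
      by (rule less.IH)
    have "koszul (u' @ x # y # v) = koszul (u' @ y # x # v)"
      using supersymmetricD[OF s, of u' v x y] that Cons by simp
    moreover have "der p koszul (u' @ x # y # v) = der p koszul (u' @ y # x # v)" for p
      using supersymmetricD[OF supersymmetric_der[OF s], of u' v p x y] that Cons by simp
    ultimately show ?thesis using Cons by simp
  qed
  then show ?case by (simp add: supersymmetric_def)
qed

lemma der_zero_ext: "(\<And>v. F v = 0) \<Longrightarrow> der p F w = 0"
  using der_cong[of p p w w F "\<lambda>_. 0"] by (simp add: der_zero)

section \<open>The action of the general linear Lie superalgebra\<close>

fun unplace :: "('a, 'b, 'n) vsymbol \<Rightarrow> 'n proper" where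
  "unplace (Place i) = i"

abbreviation placed :: "(('a, 'b, 'n) vsymbol \<times> 't) list \<Rightarrow> bool" where
  "placed w \<equiv> fst ` set w \<subseteq> range Place"

definition koszul_ext :: "(('a, 'b, 'n) vsymbol \<times> 'n) list \<Rightarrow> 'n proper uea" where
  "koszul_ext w = (if placed w then koszul (map (map_prod unplace id) w) else 0)"

lemma koszul_ext_map:
  "koszul_ext (map (map_prod Place id) v :: (('a, 'b, 'n) vsymbol \<times> 'n) list) = koszul v"
  (is "koszul_ext ?w = _")
proof -
  have "placed ?w" by force
  moreover have "map (map_prod unplace id) ?w = v" by (induction v) auto
  ultimately show ?thesis by (simp only: koszul_ext_def if_True simp_thms)
qed

lemma placedE:
  assumes "placed w"
  obtains v where "w = map (map_prod Place id) v"
proof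
  show "w = map (map_prod Place id) (map (map_prod unplace id) w)"
    using assms by (induction w) auto
qed

lemma der_map_Place:
  "der (Place i, Place k) F (map (map_prod Place id) v)
    = der (i, k) (\<lambda>u. F (map (map_prod Place id) u)) v"
  by (induction v arbitrary: F)
    (auto simp: e_parity_def letter_parity_def parity_vsymbol_def parity_proper_def)

text \<open>The superderivation changes only letters whose symbol is \<open>Place k\<close>, so a
  virtual letter present in \<open>w\<close> survives in every term.\<close>

lemma der_not_placed:
  assumes "\<And>v. \<not> placed v \<Longrightarrow> F v = 0" "\<not> placed w"
  shows "der (a, Place k) F w = 0"
  using assms
proof (induction w arbitrary: F)
  case (Cons x w)
  show ?case
  proof (cases "fst x \<in> range Place")
    case True
    then have "\<not> placed w" using Cons.prems(2) by simp
    moreover have "der (a, Place k) (\<lambda>v. F (x # v)) w = 0"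
      by (rule Cons.IH) (use Cons.prems \<open>\<not> placed w\<close> in auto)
    ultimately show ?thesis using Cons.prems(1)[of "(a, snd x) # w"] by simp
  next
    case False
    then have "der (a, Place k) (\<lambda>v. F (x # v)) w = 0"
      by (intro der_zero_ext Cons.prems(1)) simp
    then show ?thesis using False by auto
  qed
qed simp

lemma supersymmetric_koszul_ext:
  "supersymmetric n (koszul_ext :: (('a, 'b, 'n) vsymbol \<times> 'n) list \<Rightarrow> _)"
  unfolding supersymmetric_def
proof (intro allI impI)
  fix u v and x y :: "('a, 'b, 'n) vsymbol \<times> 'n"
  show "koszul_ext (u @ x # y # v)
    = (-1) ^ (letter_parity x * letter_parity y) * koszul_ext (u @ y # x # v)"
  proof (cases "placed (u @ x # y # v)")
    case True
    then have xy: "letter_parity x = 2"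
      by (auto simp: letter_parity_def parity_vsymbol_def parity_proper_def)
    let ?m = "map (map_prod unplace id)"
    have "koszul (?m u @ map_prod unplace id x # map_prod unplace id y # ?m v)
      = koszul (?m u @ map_prod unplace id y # map_prod unplace id x # ?m v)"
      using supersymmetricD[OF supersymmetric_koszul refl,
          of "?m u" "map_prod unplace id x" "map_prod unplace id y" "?m v"] by simp
    then show ?thesis using True xy by (simp add: koszul_ext_def)
  next
    case False
    then show ?thesis by (auto simp: koszul_ext_def)
  qed
qed

text \<open>Multiplication by \<open>e\<^sub>a\<^sub>b\<close> applied to \<open>\<Sum>\<^sub>t (t, t)\<close>: this is how the derivation acts on the
  exponential factor.\<close>

definition mul :: "('a, 'b, 'n) vsymbol \<times> ('a, 'b, 'n) vsymbol
    \<Rightarrow> ((('a, 'b, 'n) vsymbol \<times> 'n) list \<Rightarrow> 'r::ring_1) \<Rightarrow> (('a, 'b, 'n) vsymbol \<times> 'n) list \<Rightarrow> 'r" where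
  "mul p F w = (case snd p of Place (Proper t) \<Rightarrow> F ((fst p, t) # w) | _ \<Rightarrow> 0)"

text \<open>With the exponential factor split off, the superderivation becomes itself plus
  multiplication by its value on the exponent. That value is zero or a letter of the same parity as
  \<open>p\<close>, so it moves to the front without a sign.\<close>

definition act :: "('a, 'b, 'n) vsymbol \<times> ('a, 'b, 'n) vsymbol
    \<Rightarrow> ((('a, 'b, 'n) vsymbol \<times> 'n) list \<Rightarrow> 'r::ring_1) \<Rightarrow> (('a, 'b, 'n) vsymbol \<times> 'n) list \<Rightarrow> 'r" where
  "act p F w = der p F w + mul p F w"

lemma mul_Place: "mul (a, Place (Proper t)) F = (\<lambda>w. F ((a, t) # w))"
  by (simp add: mul_def fun_eq_iff)

lemma mul_add: "mul p (\<lambda>v. F v + G v) w = mul p F w + mul p G w"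
  by (auto simp: mul_def split: vsymbol.split proper.split)

lemma mul_mult_left: "mul p (\<lambda>v. c * F v) w = c * mul p F w"
  by (auto simp: mul_def split: vsymbol.split proper.split)

lemma act_add: "act p (\<lambda>v. F v + G v) w = act p F w + act p G w"
  by (simp add: act_def der_add mul_add algebra_simps)

lemma act_mult_left: "act p (\<lambda>v. c * F v) w = c * act p F w"
  by (simp add: act_def der_mult_left mul_mult_left algebra_simps)

text \<open>Leibniz rule for the letter that \<open>mul\<close> puts in front: the superderivation
  either changes it, which requires \<open>b = c\<close>, or passes over it with a sign.\<close>

lemma mul_der:
  fixes F :: "(('a, 'b, 'n) vsymbol \<times> 'n) list \<Rightarrow> 'r::ring_1"
  shows "mul (c, d) (der (a, b) F) w = of_bool (b = c) * mul (a, d) F w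
    + (-1) ^ (e_parity (a, b) * e_parity (c, d)) * der (a, b) (mul (c, d) F) w"
proof (cases d)
  case (Place i)
  then show ?thesis
    by (cases i) (auto simp: mul_Place e_parity_def letter_parity_def parity_vsymbol_def parity_proper_def)
qed (auto simp: mul_def der_zero_ext)

lemma mul_supercommute:
  fixes F :: "(('a, 'b, 'n) vsymbol \<times> 'n) list \<Rightarrow> 'r::ring_1"
  assumes "\<And>n. supersymmetric n F"
  shows "mul (c, d) (mul (a, b) F) w
    = (-1) ^ (e_parity (a, b) * e_parity (c, d)) * mul (a, b) (mul (c, d) F) w"
proof (cases "b \<in> range Place \<and> d \<in> range Place")
  case True
  then obtain t t' where bd: "b = Place (Proper t)" "d = Place (Proper t')"
    by (metis proper.exhaust rangeE)
  have "F ((a, t) # (c, t') # w)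
      = (-1) ^ (letter_parity (a, t) * letter_parity (c, t')) * F ((c, t') # (a, t) # w)"
    using supersymmetricD[OF assms refl, of "[]" "(a, t)" "(c, t')" w] by simp
  moreover have "letter_parity (a, t) = e_parity (a, b)" "letter_parity (c, t') = e_parity (c, d)"
    by (simp_all add: bd letter_parity_def e_parity_def parity_vsymbol_def parity_proper_def)
  ultimately show ?thesis unfolding bd mul_Place by simp
next
  case False
  have "mul (g, k) G = (\<lambda>w. 0)" if "k \<notin> range Place" 
    for g k :: "('a, 'b, 'n) vsymbol" and G :: "(('a, 'b, 'n) vsymbol \<times> 'n) list \<Rightarrow> 'r"
    using that by (cases k) (auto simp: mul_def)
  moreover have "mul p (\<lambda>w. 0 :: 'r) w = 0" for p
    by (auto simp: mul_def split: vsymbol.split proper.split)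
  ultimately show ?thesis using False by auto
qed

text \<open>Both operators are split into their two parts. Superderivations satisfy the bracket
  relation, multiplications supercommute because \<open>F\<close> is supersymmetric, and the mixed
  parts reduce by \<open>mul_der\<close> to the multiplication terms on the right.\<close>

lemma act_supercommute:
  fixes F :: "(('a, 'b, 'n) vsymbol \<times> 'n) list \<Rightarrow> 'r::ring_1"
  assumes F: "\<And>n. supersymmetric n F"
  shows "act (c, d) (act (a, b) F) w
     - (-1) ^ (e_parity (a, b) * e_parity (c, d)) * act (a, b) (act (c, d) F) w
   = of_bool (b = c) * act (a, d) F w
     - (-1) ^ (e_parity (a, b) * e_parity (c, d)) * (of_bool (a = d) * act (c, b) F w)"
proof -
  define s :: 'r where "s = (-1) ^ (e_parity (a, b) * e_parity (c, d))"
  have s: "s = 1 \<or> s = -1" unfolding s_def by (rule sign_cases)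
  have A: "act q (act p F) w = der q (der p F) w + der q (mul p F) w + mul q (der p F) w
      + mul q (mul p F) w" for p q
  proof -
    have "act p F = (\<lambda>v. der p F v + mul p F v)" by (simp add: act_def fun_eq_iff)
    then show ?thesis by (simp add: act_add) (simp add: act_def algebra_simps)
  qed
  have 1: "mul (c, d) (der (a, b) F) w = of_bool (b = c) * mul (a, d) F w
      + s * der (a, b) (mul (c, d) F) w"
    unfolding s_def by (rule mul_der)
  have 2: "mul (a, b) (der (c, d) F) w = of_bool (a = d) * mul (c, b) F w
      + s * der (c, d) (mul (a, b) F) w"
    using mul_der[of a b c d F w] unfolding s_def by (simp add: mult.commute eq_commute)
  have 3: "mul (c, d) (mul (a, b) F) w = s * mul (a, b) (mul (c, d) F) w"
    unfolding s_def by (rule mul_supercommute[OF F])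
  have 4: "der (c, d) (der (a, b) F) w = s * der (a, b) (der (c, d) F) w
      + of_bool (b = c) * der (a, d) F w - s * (of_bool (a = d) * der (c, b) F w)"
    using der_supercommute[of c d a b F w] by (simp add: s_def algebra_simps)
  show ?thesis
    unfolding A 1 2 3 4 s_def[symmetric] unfolding act_def
    using s by (elim disjE; simp add: algebra_simps)
qed

lemma supersymmetric_act:
  fixes F :: "(('a, 'b, 'n) vsymbol \<times> 'n) list \<Rightarrow> 'r::ring_1"
  assumes "\<And>n. supersymmetric n F"
  shows "supersymmetric n (act p F)"
  unfolding supersymmetric_def
proof (intro allI impI)
  fix u v and x y :: "('a, 'b, 'n) vsymbol \<times> 'n"
  show "act p F (u @ x # y # v)
    = (-1) ^ (letter_parity x * letter_parity y) * act p F (u @ y # x # v)"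
    using supersymmetricD[OF supersymmetric_der[OF assms] refl, of p u x y v]
      supersymmetricD[OF assms refl, of "_ # u" x y v]
    by (auto simp: act_def mul_def algebra_simps split: vsymbol.split proper.split)
qed

text \<open>On words in proper letters this is the recursion of \<open>koszul\<close> read
  backwards; on all others both sides vanish. It is the intertwining property that ties the action
  to left multiplication in the enveloping algebra.\<close>

lemma act_koszul_ext:
  "act (Place i, Place (Proper t)) koszul_ext w = e_gen i (Proper t) * koszul_ext w"
proof (cases "placed w")
  case True
  then obtain v where v: "w = map (map_prod Place id) v" by (rule placedE)
  have "koszul_ext ((Place i, t) # w) = koszul ((i, t) # v)"
    using koszul_ext_map[of "(i, t) # v"] v by simp
  moreover have "der (Place i, Place (Proper t)) koszul_ext w = der (i, Proper t) koszul v"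
    by (simp add: v der_map_Place koszul_ext_map)
  ultimately show ?thesis
    by (simp add: act_def mul_def koszul_ext_map v)
next
  case False
  moreover have "der (Place i, Place (Proper t)) koszul_ext w = 0"
    by (rule der_not_placed[OF _ False]) (simp add: koszul_ext_def)
  ultimately show ?thesis by (simp add: act_def mul_def koszul_ext_def)
qed

text \<open>The first factor is applied to the functional first; dually, the last factor is the
  first to act on the argument. At the argument \<open>[]\<close> a product thus acts on the vacuum
  from its right end.\<close>

primrec acts :: "(('a, 'b, 'n) vsymbol \<times> ('a, 'b, 'n) vsymbol) list
    \<Rightarrow> ((('a, 'b, 'n) vsymbol \<times> 'n) list \<Rightarrow> 'r::ring_1) \<Rightarrow> (('a, 'b, 'n) vsymbol \<times> 'n) list \<Rightarrow> 'r" where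
  "acts [] F = F"
| "acts (p # w) F = acts w (act p F)"

lemma acts_append: "acts (u @ v) F = acts v (acts u F)"
  by (induction u arbitrary: F) simp_all

lemma acts_add: "acts u (\<lambda>v. F v + G v) w = acts u F w + acts u G w"
proof (induction u arbitrary: F G)
  case (Cons p u)
  have "act p (\<lambda>v. F v + G v) = (\<lambda>v. act p F v + act p G v)"
    by (simp add: fun_eq_iff act_add)
  then show ?case using Cons.IH by simp
qed simp

lemma acts_mult_left: "acts u (\<lambda>v. c * F v) w = c * acts u F w"
proof (induction u arbitrary: F)
  case (Cons p u)
  have "act p (\<lambda>v. c * F v) = (\<lambda>v. c * act p F v)"
    by (simp add: fun_eq_iff act_mult_left)
  then show ?case using Cons.IH by simp
qed simp

lemma supersymmetric_acts:
  fixes F :: "(('a, 'b, 'n) vsymbol \<times> 'n) list \<Rightarrow> 'r::ring_1"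
  assumes "\<And>n. supersymmetric n F"
  shows "supersymmetric n (acts u F)"
  using assms by (induction u arbitrary: F n) (simp_all add: supersymmetric_act)

section \<open>The projection onto the enveloping algebra\<close>

definition scalar :: "complex \<Rightarrow> 's::symbol uea" where
  "scalar c = uea_of (Poly_Mapping.single 0 c)"

lemma scalar_0: "scalar 0 = 0"
  by (simp add: scalar_def uea_of_zero)

lemma scalar_1: "scalar 1 = 1"
  by (simp add: scalar_def uea_of_one)

lemma scalar_add: "scalar (a + b) = scalar a + scalar b"
  by (simp add: scalar_def single_add uea_of_add)

lemma scalar_mult: "scalar (a * b) = scalar a * scalar b"
  by (simp add: scalar_def mult_single flip: uea_of_mult)

lemma uea_of_single: "uea_of (Poly_Mapping.single (Word w) c) = scalar c * uea_of (word w)"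
  by (simp add: scalar_def word_def mult_single flip: uea_of_mult)

definition eval_acts :: "(('a, 'b, 'n) vsymbol \<times> ('a, 'b, 'n) vsymbol) free_alg
    \<Rightarrow> ((('a, 'b, 'n) vsymbol \<times> 'n) list \<Rightarrow> 'm::symbol uea)
    \<Rightarrow> (('a, 'b, 'n) vsymbol \<times> 'n) list \<Rightarrow> 'm uea" where
  "eval_acts x F v
     = (\<Sum>w\<in>Poly_Mapping.keys x. scalar (Poly_Mapping.lookup x w) * acts (letters w) F v)"

lemma eval_acts_superset:
  assumes "finite A" "Poly_Mapping.keys x \<subseteq> A"
  shows "eval_acts x F v = (\<Sum>w\<in>A. scalar (Poly_Mapping.lookup x w) * acts (letters w) F v)"
  unfolding eval_acts_def
  by (rule sum.mono_neutral_left) (use assms in \<open>auto simp: in_keys_iff scalar_0\<close>)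

lemma eval_acts_add: "eval_acts (x + y) F v = eval_acts x F v + eval_acts y F v"
proof -
  let ?A = "Poly_Mapping.keys x \<union> Poly_Mapping.keys y"
  have "Poly_Mapping.keys (x + y) \<subseteq> ?A" by (rule Poly_Mapping.keys_add)
  then show ?thesis
    by (simp add: eval_acts_superset[of ?A] lookup_add scalar_add sum.distrib algebra_simps)
qed

lemma eval_acts_zero: "eval_acts 0 F v = 0"
  by (simp add: eval_acts_def)

lemma eval_acts_uminus: "eval_acts (- x) F v = - eval_acts x F v"
  using eval_acts_add[of x "- x" F v] by (simp add: eval_acts_zero add_eq_0_iff)

lemma eval_acts_diff: "eval_acts (x - y) F v = eval_acts x F v - eval_acts y F v"
  using eval_acts_add[of x "- y" F v] by (simp add: eval_acts_uminus)

lemma eval_acts_single: "eval_acts (Poly_Mapping.single (Word w) c) F v = scalar c * acts w F v"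
  by (simp add: eval_acts_def scalar_0)

lemma eval_acts_word: "eval_acts (word w) F v = acts w F v"
  by (simp add: word_def eval_acts_single scalar_1)

lemma eval_acts_sign_mult: "eval_acts ((-1) ^ k * x) F v = (-1) ^ k * eval_acts x F v"
  by (simp add: minus_one_power_iff eval_acts_uminus)

lemma eval_acts_of_bool_mult: "eval_acts (of_bool P * x) F v = of_bool P * eval_acts x F v"
  by (simp add: eval_acts_zero)

lemma eval_acts_fun_add:
  "eval_acts x (\<lambda>v. F v + G v) w = eval_acts x F w + eval_acts x G w"
  by (simp add: eval_acts_def acts_add algebra_simps sum.distrib)

lemma eval_acts_fun_zero: "eval_acts x (\<lambda>v. 0) w = 0"
  using eval_acts_fun_add[of x "\<lambda>v. 0" "\<lambda>v. 0" w] by simp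

lemma eval_acts_mult: "eval_acts (x * y) F = eval_acts y (eval_acts x F)"
proof (induction x rule: free_alg_induct)
  case (single u c)
  have F: "eval_acts (Poly_Mapping.single (Word u) c) F = (\<lambda>v. scalar c * acts u F v)"
    by (simp add: fun_eq_iff eval_acts_single)
  show ?case
  proof (induction y rule: free_alg_induct)
    case (single w d)
    show ?case
      by (simp add: F fun_eq_iff eval_acts_single mult_single plus_free_word_def acts_append
          acts_mult_left mult.commute[of c d] scalar_mult mult.assoc)
  qed (simp add: distrib_left fun_eq_iff eval_acts_add)
next
  case (add x x')
  have "eval_acts (x + x') F = (\<lambda>v. eval_acts x F v + eval_acts x' F v)"
    by (simp add: fun_eq_iff eval_acts_add)
  then show ?case
    using add by (simp add: distrib_right fun_eq_iff eval_acts_add eval_acts_fun_add)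
qed

lemma supersymmetric_eval_acts:
  fixes F :: "(('a, 'b, 'n) vsymbol \<times> 'n) list \<Rightarrow> 'm::symbol uea"
  assumes "\<And>n. supersymmetric n F"
  shows "supersymmetric n (eval_acts x F)"
  unfolding supersymmetric_def
proof (intro allI impI)
  fix u v and y z :: "('a, 'b, 'n) vsymbol \<times> 'n"
  let ?s = "(-1) ^ (letter_parity y * letter_parity z) :: 'm uea"
  have "acts w F (u @ y # z # v) = ?s * acts w F (u @ z # y # v)" for w
    by (rule supersymmetricD[OF supersymmetric_acts[OF assms] refl])
  then show "eval_acts x F (u @ y # z # v) = ?s * eval_acts x F (u @ z # y # v)"
    using sign_cases[where 'r="'m uea", of "letter_parity y * letter_parity z"]
    by (elim disjE) (simp_all add: eval_acts_def sum_negf)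
qed

lemma eval_acts_uea_relations:
  assumes "r \<in> uea_relations" "\<And>n. supersymmetric n F"
  shows "eval_acts r F v = 0"
proof -
  obtain a b c d where "r = word [(a, b), (c, d)]
      - (-1) ^ (e_parity (a, b) * e_parity (c, d)) * word [(c, d), (a, b)]
      - superbracket (a, b) (c, d)"
    using assms(1) by (auto simp: uea_relations_def)
  then show ?thesis
    using act_supercommute[OF assms(2), of c d a b v]
    by (simp add: eval_acts_diff eval_acts_sign_mult eval_acts_of_bool_mult eval_acts_word
        superbracket_def mult.assoc)
qed

text \<open>In \<open>x * r * y\<close> the factor \<open>x\<close> is applied to the functional
  first. The result is again supersymmetric, so the relation \<open>r\<close> sends it to
  zero.\<close>

lemma eval_acts_uea_ideal:
  assumes "x \<in> uea_ideal" "\<And>n. supersymmetric n F"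
  shows "eval_acts x F v = 0"
  using assms(1) unfolding uea_ideal_def
proof (induction rule: two_sided_ideal_gen.induct)
  case (gen r x y)
  then have "eval_acts r (eval_acts x F) = (\<lambda>v. 0)"
    using eval_acts_uea_relations[OF _ supersymmetric_eval_acts[OF assms(2)]] by blast
  then show ?case by (simp add: eval_acts_mult eval_acts_fun_zero)
qed (simp_all add: eval_acts_zero eval_acts_add)

text \<open>The empty word stands for the vacuum. This is an explicit candidate for
  \<open>capelli_proj\<close>, available on the whole enveloping algebra.\<close>

lift_definition devirtualize :: "('a, 'b, 'n) vsymbol uea \<Rightarrow> 'n proper uea" is
  "\<lambda>x. eval_acts x koszul_ext []"
  using eval_acts_uea_ideal[OF _ supersymmetric_koszul_ext, of _ "[]"]
  by (metis eval_acts_diff right_minus_eq)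

lemma devirtualize_add: "devirtualize (x + y) = devirtualize x + devirtualize y"
  by transfer (rule eval_acts_add)

lemma devirtualize_word: "devirtualize (uea_of (word w)) = acts w koszul_ext []"
  by (simp add: devirtualize.abs_eq eval_acts_word)

text \<open>The coefficient \<open>c\<close> collects the generators already produced by
  \<open>act_koszul_ext\<close>; it has to be arbitrary for the induction.\<close>

lemma acts_map_Place:
  fixes v :: "(('a, 'b, 'n) vsymbol \<times> 'n) list"
  shows "acts (map (map_prod Place Place) w) (\<lambda>v. c * koszul_ext v) v
    = c * (uea_of (word w) * koszul_ext v)"
proof (induction w arbitrary: c)
  case (Cons p w)
  obtain i t where p: "p = (i, Proper t)" by (metis proper.exhaust surj_pair)
  have "act (Place i, Place (Proper t)) (\<lambda>v. c * koszul_ext v)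
      = (\<lambda>v :: (('a, 'b, 'n) vsymbol \<times> 'n) list. c * e_gen i (Proper t) * koszul_ext v)"
    by (simp add: fun_eq_iff act_mult_left act_koszul_ext mult.assoc)
  then show ?case
    using Cons.IH[of "c * e_gen i (Proper t)"] by (simp add: p uea_of_word mult.assoc)
qed (simp add: word_Nil uea_of_one)

text \<open>By the intertwining property a proper product acting on the vacuum gives back the
  product itself. Together with \<open>devirtualize_Irr\<close> this makes the decomposition into a
  proper element and an element of \<open>Irr\<close> unique.\<close>

lemma devirtualize_incl: "devirtualize (incl x :: ('a, 'b, 'n) vsymbol uea) = x"
proof -
  obtain y where x: "x = uea_of y" by (rule uea_of_cases)
  have "eval_acts (relabel Place y) (koszul_ext :: (('a, 'b, 'n) vsymbol \<times> 'n) list \<Rightarrow> _) [] = uea_of y"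
  proof (induction y rule: free_alg_induct)
    case (single w c)
    have "koszul_ext ([] :: (('a, 'b, 'n) vsymbol \<times> 'n) list) = 1" by (simp add: koszul_ext_def)
    then show ?case
      using acts_map_Place[where v = "[] :: (('a, 'b, 'n) vsymbol \<times> 'n) list", of w 1]
      by (simp add: relabel_single eval_acts_single uea_of_single)
  qed (simp add: relabel_add eval_acts_add uea_of_add)
  then show ?thesis by (simp add: x incl.abs_eq devirtualize.abs_eq)
qed

section \<open>Weights of virtual symbols, and irregular products\<close>

lemma der_eq_0_weight:
  assumes "\<And>v'. count_list (map fst v') \<gamma> + of_bool (b = \<gamma>)
      = count_list (map fst v) \<gamma> + of_bool (a = \<gamma>) \<Longrightarrow> F v' = 0"
  shows "der (a, b) F v = 0"
  using assms
proof (induction v arbitrary: F)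
  case (Cons x v)
  have "der (a, b) (\<lambda>v. F (x # v)) v = 0"
    by (intro Cons.IH Cons.prems) auto
  moreover have "fst x = b \<Longrightarrow> F ((a, snd x) # v) = 0"
    by (rule Cons.prems) auto
  ultimately show ?case by simp
qed simp

text \<open>The number of letters with symbol \<gamma> changes by the weight of
  \<open>(a, b)\<close>: it drops by one for \<open>b\<close> and grows by one for \<open>a\<close>.
  The multiplication part obeys this too, since it needs a proper \<open>b\<close>, which differs
  from the virtual \<gamma>.\<close>

lemma act_eq_0_weight:
  assumes "\<gamma> \<notin> range Place"
    and "\<And>v'. count_list (map fst v') \<gamma> + of_bool (b = \<gamma>)
      = count_list (map fst v) \<gamma> + of_bool (a = \<gamma>) \<Longrightarrow> F v' = 0"
  shows "act (a, b) F v = 0"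
proof -
  have "b \<noteq> \<gamma>" if "b \<in> range Place" using that assms(1) by blast
  then have "mul (a, b) F v = 0"
    by (auto simp: mul_def intro!: assms(2) split: vsymbol.split proper.split)
  then show ?thesis
    by (simp add: act_def der_eq_0_weight[OF assms(2)])
qed

text \<open>The factors \<open>p # w\<close> would have to remove more letters with symbol \<gamma>
  than \<open>v\<close> contains and \<open>w\<close> creates.\<close>

lemma acts_eq_0:
  assumes "\<gamma> \<notin> range Place"
    and "count_list (map snd (p # w)) \<gamma> > count_list (map fst v) \<gamma> + count_list (map fst w) \<gamma>"
  shows "acts (u @ p # w) F v = 0"
  using assms(2)
\<comment> \<open>The last factor acts on \<open>v\<close> first, so the word is taken apart from
  its right end.\<close>
proof (induction w arbitrary: v rule: rev_induct)
  case Nil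
  obtain a b where p: "p = (a, b)" by (cases p)
  have "act (a, b) (acts u F) v = 0"
  proof -
    have "count_list (map fst v) \<gamma> = 0" "b = \<gamma>"
      using Nil by (auto simp: p split: if_splits)
    moreover from this have "mul (a, b) (acts u F) v = 0"
      using assms(1) by (auto simp: mul_def split: vsymbol.split)
    moreover have "der (a, b) (acts u F) v = 0"
      by (rule der_eq_0) (use \<open>count_list (map fst v) \<gamma> = 0\<close> \<open>b = \<gamma>\<close> in \<open>auto simp: count_list_0_iff\<close>)
    ultimately show ?thesis by (simp add: act_def)
  qed
  then show ?case by (simp add: acts_append p)
next
  case (snoc q w)
  obtain a b where q: "q = (a, b)" by (cases q)
  have "act (a, b) (acts (u @ p # w) F) v = 0"
    using snoc.prems
    by (intro act_eq_0_weight[OF assms(1)] snoc.IH) (auto simp: q split: if_splits)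
  then show ?case by (simp add: acts_append q)
qed

lemma card_eq_count_list_take:
  "i \<le> length r \<Longrightarrow> card {k \<in> {1..i}. f (r ! (k - 1)) = \<gamma>} = count_list (map f (take i r)) \<gamma>"
proof (induction i)
  case (Suc i)
  have "{k \<in> {1..Suc i}. f (r ! (k - 1)) = \<gamma>}
      = {k \<in> {1..i}. f (r ! (k - 1)) = \<gamma>} \<union> (if f (r ! i) = \<gamma> then {Suc i} else {})"
    by (auto simp: le_Suc_eq)
  then show ?case using Suc by (simp add: take_Suc_conv_app_nth card_insert_if)
qed simp

text \<open>The first \<open>i\<close> factors counted from the right form the suffix
  \<open>p # v\<close>, and \<open>p\<close> is the \<open>i\<close>-th. The strict bound on the
  created symbols leaves \<open>p\<close> out of their count.\<close>

lemma irregular_iff: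
  "irregular w \<longleftrightarrow> (\<exists>u p v \<gamma>. w = u @ p # v \<and> \<gamma> \<notin> range Place
     \<and> count_list (map snd (p # v)) \<gamma> > count_list (map fst v) \<gamma>)"
proof -
  have virtual: "range Alpha \<union> range Beta = - range Place"
    by (auto simp: image_iff) (metis vsymbol.exhaust)
  let ?r = "rev w"
  have interval: "{1..<i} = {1..i - 1}" for i :: nat by auto
  have eq: "irregular w \<longleftrightarrow> (\<exists>i \<in> {1..length w}. \<exists>\<gamma> \<in> - range Place.
      count_list (map snd (take i ?r)) \<gamma> > count_list (map fst (take (i - 1) ?r)) \<gamma>)"
    unfolding irregular_def Let_def virtual interval
  proof (intro bex_cong refl)
    fix i \<gamma>
    assume "i \<in> {1..length w}"
    then have "i \<le> length ?r" "i - 1 \<le> length ?r" by auto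
    note count = this[THEN card_eq_count_list_take]
    show "(card {k \<in> {1..i - 1}. fst (?r ! (k - 1)) = \<gamma>} < card {k \<in> {1..i}. snd (?r ! (k - 1)) = \<gamma>})
      = (count_list (map fst (take (i - 1) ?r)) \<gamma> < count_list (map snd (take i ?r)) \<gamma>)"
      by (simp only: count)
  qed
  show ?thesis
  proof
    assume "irregular w"
    then obtain i \<gamma> where i: "1 \<le> i" "i \<le> length w" "\<gamma> \<notin> range Place"
      "count_list (map snd (take i ?r)) \<gamma> > count_list (map fst (take (i - 1) ?r)) \<gamma>"
      unfolding eq by auto
    have t: "take i ?r = take (i - 1) ?r @ [?r ! (i - 1)]"
      using take_Suc_conv_app_nth[of "i - 1" ?r] i by simp
    have "?r = take i ?r @ drop i ?r" by simp
    then have "w = rev (drop i ?r) @ ?r ! (i - 1) # rev (take (i - 1) ?r)"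
      unfolding t by (metis append.assoc append_Cons append_Nil rev.simps rev_append rev_rev_ident)
    moreover have "count_list (map snd (?r ! (i - 1) # rev (take (i - 1) ?r))) \<gamma>
        > count_list (map fst (rev (take (i - 1) ?r))) \<gamma>"
      using i(4) unfolding t by (simp flip: rev_map split: if_splits)
    ultimately show "\<exists>u p v \<gamma>. w = u @ p # v \<and> \<gamma> \<notin> range Place
     \<and> count_list (map snd (p # v)) \<gamma> > count_list (map fst v) \<gamma>" using i(3) by blast
  next
    assume "\<exists>u p v \<gamma>. w = u @ p # v \<and> \<gamma> \<notin> range Place
     \<and> count_list (map snd (p # v)) \<gamma> > count_list (map fst v) \<gamma>"
    then obtain u p v \<gamma> where w: "w = u @ p # v" "\<gamma> \<notin> range Place"
      "count_list (map snd (p # v)) \<gamma> > count_list (map fst v) \<gamma>" by blast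
    then show "irregular w"
      unfolding eq by (intro bexI[of _ "Suc (length v)"] bexI[of _ \<gamma>]) (auto simp flip: rev_map)
  qed
qed

text \<open>In \<open>x * r\<close> the irregular word \<open>r\<close> acts on the vacuum first and
  kills it, whatever functional \<open>x\<close> produces.\<close>

lemma devirtualize_Irr: "y \<in> Irr \<Longrightarrow> devirtualize y = 0"
  unfolding Irr_def
proof (induction rule: left_ideal_gen.induct)
  case zero
  then show ?case by (simp add: zero_uea_def devirtualize.abs_eq eval_acts_zero)
next
  case (gen r x)
  then obtain w where w: "r = uea_of (word w)" "irregular w" by blast
  then obtain u p v \<gamma> where "w = u @ p # v" "\<gamma> \<notin> range Place"
    "count_list (map snd (p # v)) \<gamma> > count_list (map fst v) \<gamma>"
    unfolding irregular_iff by blast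
  then have "acts w F [] = 0" for F :: "_ \<Rightarrow> 'c proper uea" by (simp only: acts_eq_0 list.map count_list.simps add_0)
  moreover obtain z where "x = uea_of z" by (rule uea_of_cases)
  ultimately show ?case
    by (simp add: w devirtualize.abs_eq eval_acts_mult eval_acts_word flip: uea_of_mult)
qed (simp add: devirtualize_add)

section \<open>The sum of the proper enveloping algebra and the left ideal\<close>

lemma incl_add: "incl (x + y) = incl x + incl y"
  by transfer (simp add: relabel_add uea_ideal_zero)

lemma incl_uminus: "incl (- x) = - incl x"
  by transfer (simp add: relabel_uminus uea_ideal_zero)

lemma incl_zero: "incl 0 = 0"
  by transfer (simp add: relabel_zero uea_ideal_zero)

lemma Irr_uminus:
  assumes "x \<in> Irr"
  shows "- x \<in> Irr"
  using assms unfolding Irr_def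
proof (induction rule: left_ideal_gen.induct)
  case (add x y)
  then show ?case using left_ideal_gen.add[OF add.IH] by (simp add: add.commute)
next
  case (gen r x)
  then show ?case using left_ideal_gen.gen[OF gen, of "- x"] by simp
qed (simp add: left_ideal_gen.zero)

definition Virt :: "('a, 'b, 'n) vsymbol uea set" where
  "Virt = {y. \<exists>x. y - incl x \<in> Irr}"

text \<open>Applying \<open>devirtualize\<close> to \<open>y - incl x\<close> shows that
  \<open>x\<close> can only be \<open>devirtualize y\<close>; membership in \<open>Virt\<close>
  supplies existence, so the description in \<open>capelli_proj\<close> is proper.\<close>

lemma capelli_proj_eq_devirtualize:
  assumes "y \<in> Virt"
  shows "capelli_proj y = devirtualize y"
proof -
  have unique: "x = devirtualize y" if "y - incl x \<in> Irr" for x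
    using devirtualize_Irr[OF that] devirtualize_add[of "y - incl x" "incl x"]
    by (simp add: devirtualize_incl)
  obtain x where x: "y - incl x \<in> Irr" using assms by (auto simp: Virt_def)
  show ?thesis
    unfolding capelli_proj_def
    by (rule the_equality) (use x unique in auto)
qed

lemma Virt_add:
  assumes "x \<in> Virt" "y \<in> Virt"
  shows "x + y \<in> Virt"
proof -
  obtain x' y' where "x - incl x' \<in> Irr" "y - incl y' \<in> Irr"
    using assms by (auto simp: Virt_def)
  then have "(x - incl x') + (y - incl y') \<in> Irr"
    unfolding Irr_def by (rule left_ideal_gen.add)
  then have "x + y - incl (x' + y') \<in> Irr"
    by (simp add: incl_add algebra_simps)
  then show ?thesis by (auto simp: Virt_def)
qed

lemma Virt_uminus:
  assumes "x \<in> Virt"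
  shows "- x \<in> Virt"
proof -
  obtain x' where "x - incl x' \<in> Irr"
    using assms by (auto simp: Virt_def)
  then have "- x - incl (- x') \<in> Irr"
    using Irr_uminus by (fastforce simp: incl_uminus)
  then show ?thesis by (auto simp: Virt_def)
qed

lemma Virt_diff: "x \<in> Virt \<Longrightarrow> y \<in> Virt \<Longrightarrow> x - y \<in> Virt"
  using Virt_add[of x "- y"] Virt_uminus[of y] by simp

lemma Irr_subset_Virt: "y \<in> Irr \<Longrightarrow> y \<in> Virt"
  unfolding Virt_def by (auto intro!: exI[of _ 0] simp: incl_zero)

lemma incl_in_Virt: "incl x \<in> Virt"
  unfolding Virt_def by (auto intro!: exI[of _ x] simp: Irr_def left_ideal_gen.zero)

lemma Virt_zero: "0 \<in> Virt"
  using incl_in_Virt[of 0] by (simp add: incl_zero)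

lemma Virt_sign_mult: "x \<in> Virt \<Longrightarrow> (-1) ^ k * x \<in> Virt"
  by (simp add: minus_one_power_iff Virt_uminus)

text \<open>These are the products of weight zero in every virtual symbol, such as the monomials
  defining column Capelli bitableaux.\<close>

definition balanced :: "(('a, 'b, 'n) vsymbol \<times> ('a, 'b, 'n) vsymbol) list \<Rightarrow> bool" where
  "balanced w \<longleftrightarrow> (\<forall>\<gamma>. \<gamma> \<notin> range Place \<longrightarrow> count_list (map fst w) \<gamma> = count_list (map snd w) \<gamma>)"

lemma uea_of_word_swap:
  "uea_of (word (u @ (a, b) # (c, d) # v))
   = (-1) ^ (e_parity (a, b) * e_parity (c, d)) * uea_of (word (u @ (c, d) # (a, b) # v))
     + (if b = c then uea_of (word (u @ (a, d) # v)) else 0)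
     - (-1) ^ (e_parity (a, b) * e_parity (c, d)) * (if a = d then uea_of (word (u @ (c, b) # v)) else 0)"
  (is "?l = ?s * ?x + ?y - ?s * ?z")
proof -
  let ?P = "\<lambda>w. \<Prod>p\<leftarrow>w. e_gen (fst p) (snd p)"
  have "?l = ?P u * (e_gen a b * e_gen c d) * ?P v"
    by (simp add: uea_of_word mult.assoc)
  also have "\<dots> = ?s * ?x + ?y - ?s * ?z"
    unfolding e_gen_supercommute[of a b c d]
    using sign_cases[of "e_parity (a, b) * e_parity (c, d)", where 'r="'a uea"]
    by (elim disjE; simp add: uea_of_word algebra_simps)
  finally show ?thesis .
qed

lemma balanced_swap: "balanced (u @ p # q # v) \<Longrightarrow> balanced (u @ q # p # v)"
proof -
  have count: "count_list (map f (u @ p # q # v)) \<gamma> = count_list (map f (u @ q # p # v)) \<gamma>" for f \<gamma>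
    by simp
  show "balanced (u @ p # q # v) \<Longrightarrow> balanced (u @ q # p # v)"
    unfolding balanced_def by (simp only: count)
qed

lemma balanced_contract:
  assumes "balanced (u @ (a, b) # (b, d) # v)"
  shows "balanced (u @ (a, d) # v)"
  unfolding balanced_def
proof (intro allI impI)
  fix \<gamma> :: "('a, 'b, 'c) vsymbol" assume "\<gamma> \<notin> range Place"
  then have "count_list (map fst (u @ (a, b) # (b, d) # v)) \<gamma>
      = count_list (map snd (u @ (a, b) # (b, d) # v)) \<gamma>"
    using assms unfolding balanced_def by blast
  then show "count_list (map fst (u @ (a, d) # v)) \<gamma> = count_list (map snd (u @ (a, d) # v)) \<gamma>"
    by (simp split: if_splits)
qed

text \<open>A factor \<open>e\<^sub>a\<^sub>\<gamma>\<close> with \<open>\<gamma>\<close> virtual is moved to the right end,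
  where it makes the word irregular; the commutators met on the way are shorter balanced words.\<close>

lemma balanced_in_Virt:
  fixes w :: "(('a, 'b, 'n) vsymbol \<times> ('a, 'b, 'n) vsymbol) list"
  assumes "balanced w"
  shows "uea_of (word w) \<in> Virt"
  using assms
proof (induction "length w" arbitrary: w rule: less_induct)
  case less
  show ?case
  proof (cases "\<exists>p \<in> set w. snd p \<notin> range Place")
    case False
    \<comment> \<open>With no virtual symbol on the right of any factor, balance forbids one on the
      left as well, so the word comes from the proper enveloping algebra.\<close>
    have "fst p \<in> range Place" if "p \<in> set w" for p
    proof (rule ccontr)
      assume *: "fst p \<notin> range Place"
      then have "count_list (map snd w) (fst p) = 0"
        using False by (auto simp: count_list_0_iff)
      then have "count_list (map fst w) (fst p) = 0"
        using less.prems * by (simp add: balanced_def)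
      with that show False by (auto simp: count_list_0_iff)
    qed
    with False have "\<exists>w'. w = map (map_prod Place Place) w'"
    proof (induction w)
      case (Cons p w)
      then obtain w' where "w = map (map_prod Place Place) w'" by auto
      moreover have "fst p \<in> range Place" "snd p \<in> range Place"
        using Cons.prems by auto
      then obtain i k where "p = (Place i, Place k)"
        by (cases p) auto
      ultimately have "p # w = map (map_prod Place Place) ((i, k) # w')" by simp
      then show ?case by (rule exI)
    qed simp
    then obtain w' where "w = map (map_prod Place Place) w'" by blast
    then have "uea_of (word w) = incl (uea_of (word w'))"
      by (simp add: incl.abs_eq relabel_word)
    then show ?thesis by (simp add: incl_in_Virt)
  next
    case True
    then obtain a b where ab: "(a, b) \<in> set w" "b \<notin> range Place" by auto
    have "uea_of (word (u @ (a, b) # v)) \<in> Virt"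
      if "length (u @ (a, b) # v) = length w" "balanced (u @ (a, b) # v)" for u v
      using that
    proof (induction v arbitrary: u)
      case Nil
      have "irregular (u @ [(a, b)])"
        unfolding irregular_iff
        by (intro exI[of _ u] exI[of _ "(a, b)"] exI[of _ "[]"] exI[of _ b]) (simp add: ab)
      then have "uea_of (word (u @ [(a, b)])) \<in> Irr"
        unfolding Irr_def
        using left_ideal_gen.gen[of _ "{uea_of (word w) | w. irregular w}" 1] by auto
      then show ?case by (rule Irr_subset_Virt)
    next
      case (Cons q v)
      obtain c d where q: "q = (c, d)" by (cases q)
      have "uea_of (word ((u @ [(c, d)]) @ (a, b) # v)) \<in> Virt"
      proof (rule Cons.IH)
        show "balanced ((u @ [(c, d)]) @ (a, b) # v)"
          using balanced_swap[of u "(a, b)" "(c, d)" v] Cons.prems(2) q by simp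
      qed (use Cons.prems(1) in simp)
      moreover have "uea_of (word (u @ (a, d) # v)) \<in> Virt" if "b = c"
      proof (rule less.hyps)
        show "balanced (u @ (a, d) # v)"
          using balanced_contract[of u a b d v] Cons.prems(2) q that by simp
      qed (use Cons.prems(1)[symmetric] in simp)
      moreover have "uea_of (word (u @ (c, b) # v)) \<in> Virt" if "a = d"
      proof (rule less.hyps)
        show "balanced (u @ (c, b) # v)"
          using balanced_contract[of u c d b v] balanced_swap[of u "(a, b)" "(c, d)" v]
            Cons.prems(2) q that by simp
      qed (use Cons.prems(1)[symmetric] in simp)
      ultimately show ?case
        unfolding q uea_of_word_swap[of u a b c d v]
        by (auto intro!: Virt_add Virt_diff Virt_sign_mult Virt_zero)
    qed
    moreover obtain u v where "w = u @ (a, b) # v" using ab split_list by fast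
    ultimately show ?thesis using less.prems by simp
  qed
qed

section \<open>Column Capelli bitableaux\<close>

lemma der_single_letter:
  assumes "\<And>x. x \<in> set u \<union> set v \<Longrightarrow> fst x \<noteq> b"
    and "\<And>x. x \<in> set u \<Longrightarrow> odd (letter_parity x)" and "odd (e_parity (a, b))"
  shows "der (a, b) F (u @ (b, t) # v) = (-1) ^ length u * F (u @ (a, t) # v)"
  using assms(1,2)
proof (induction u arbitrary: F)
  case Nil
  then have "der (a, b) G v = 0" for G :: "_ \<Rightarrow> 'c"
    by (intro der_eq_0) auto
  then show ?case by simp
next
  case (Cons x u)
  have "der (a, b) (\<lambda>v. F (x # v)) (u @ (b, t) # v) = (-1) ^ length u * F (x # u @ (a, t) # v)"
    by (rule Cons.IH) (use Cons.prems in auto)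
  moreover have "fst x \<noteq> b" "odd (letter_parity x)" using Cons.prems by auto
  ultimately show ?case by (simp add: minus_one_power_iff assms(3))
qed

text \<open>All letters created so far are virtual, so the superderivation part of each factor
  vanishes and its multiplication part puts one more letter in front.\<close>

lemma acts_create:
  assumes "length \<alpha>s = length js" "set \<alpha>s \<subseteq> range Alpha"
  shows "acts (map2 (\<lambda>\<alpha> j. (\<alpha>, Place (Proper j))) \<alpha>s js) F [] = F (zip \<alpha>s js)"
  using assms
proof (induction \<alpha>s js arbitrary: F rule: list_induct2)
  case (Cons \<alpha> \<alpha>s j js)
  have "der (\<alpha>, Place (Proper j)) F (zip \<alpha>s js) = 0"
    using Cons.prems by (intro der_eq_0) (auto dest!: set_zip_leftD)
  then show ?case using Cons by (simp add: act_def mul_def)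
qed simp

text \<open>Working from the right, each factor turns its odd letter with symbol \<alpha> into an
  even proper letter and passes over the odd letters still to its left. These are the prefix
  \<open>u\<close> and the earlier letters of the zipped list, whence the exponent.\<close>

lemma acts_annihilate:
  assumes "length is = length \<alpha>s" "length \<alpha>s = length js" "distinct \<alpha>s" "set \<alpha>s \<subseteq> range Alpha"
    and "fst ` set u \<subseteq> range Alpha - set \<alpha>s"
  shows "acts (map2 (\<lambda>i \<alpha>. (Place (Proper i), \<alpha>)) is \<alpha>s) F (u @ zip \<alpha>s js)
    = (-1) ^ (length is * length u + \<Sum>{..<length is}) * F (u @ zip (map (\<lambda>i. Place (Proper i)) is) js)"
  using assms
proof (induction "is" \<alpha>s js arbitrary: F u rule: list_induct3)
  case (Cons i "is" \<alpha> \<alpha>s j js)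
  let ?h = "length is" and ?v = "zip (map (\<lambda>i. Place (Proper i)) is) js" and ?p = "(Place (Proper i), \<alpha>)"
  obtain \<gamma> where \<alpha>: "\<alpha> = Alpha \<gamma>" using Cons.prems by auto
  have "der ?p F (u @ (\<alpha>, j) # ?v) = (-1) ^ length u * F (u @ (Place (Proper i), j) # ?v)"
  proof (rule der_single_letter)
    show "fst x \<noteq> \<alpha>" if "x \<in> set u \<union> set ?v" for x
      using that Cons.prems by (cases x) (auto simp: \<alpha> dest!: set_zip_leftD)
    show "odd (letter_parity x)" if "x \<in> set u" for x
      using that Cons.prems by (force simp: letter_parity_def parity_vsymbol_def)
    show "odd (e_parity ?p)"
      by (simp add: \<alpha> e_parity_def parity_vsymbol_def parity_proper_def)
  qed
  then have F: "act ?p F (u @ (\<alpha>, j) # ?v) = (-1) ^ length u * F (u @ (Place (Proper i), j) # ?v)"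
    by (simp add: act_def mul_def \<alpha>)
  \<comment> \<open>The remaining factors act first, while the letter with symbol \<alpha> is still
    unchanged; for them it belongs to the prefix.\<close>
  have "acts (map2 (\<lambda>i \<alpha>. (Place (Proper i), \<alpha>)) is \<alpha>s) (act ?p F) ((u @ [(\<alpha>, j)]) @ zip \<alpha>s js)
    = (-1) ^ (?h * length (u @ [(\<alpha>, j)]) + \<Sum>{..<?h}) * act ?p F ((u @ [(\<alpha>, j)]) @ ?v)"
    by (rule Cons.IH) (use Cons.prems in auto)
  moreover have "(-1) ^ (?h * length (u @ [(\<alpha>, j)]) + \<Sum>{..<?h}) * ((-1) ^ length u * y)
      = (-1) ^ (Suc ?h * length u + \<Sum>{..<Suc ?h}) * y" for y :: 'd
    by (simp add: lessThan_Suc algebra_simps flip: power_add mult.assoc)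
  ultimately show ?case by (simp add: F del: sum.lessThan_Suc)
qed simp

text \<open>The defining monomial is balanced, hence in \<open>Virt\<close>, and its projection is
  computed on the vacuum: one half creates the virtual letters, the other makes them proper. The
  result is visibly independent of the auxiliary symbols.\<close>

lemma column_capelli_eq_koszul:
  fixes \<alpha>s :: "('a, 'b, 'n) vsymbol list"
  assumes "distinct \<alpha>s" "set \<alpha>s \<subseteq> range Alpha" "length is = length \<alpha>s" "length js = length \<alpha>s"
  shows "column_capelli \<alpha>s is js = (-1) ^ (\<Sum>{..<length \<alpha>s}) * koszul (zip (map Proper is) js)"
proof -
  let ?u = "map2 (\<lambda>i \<alpha>. (Place (Proper i), \<alpha>)) is \<alpha>s"
    and ?v = "map2 (\<lambda>\<alpha> j. (\<alpha>, Place (Proper j))) \<alpha>s js"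
  have fst: "map fst ?u = map (\<lambda>i. Place (Proper i)) is" "map snd ?u = \<alpha>s"
    "map fst ?v = \<alpha>s" "map snd ?v = map (\<lambda>i. Place (Proper i)) js"
    using assms by (auto intro!: nth_equalityI)
  have "count_list (map (\<lambda>i. Place (Proper i)) ks) \<gamma> = 0" if "\<gamma> \<notin> range Place"
    for ks :: "'n list" and \<gamma> :: "('a, 'b, 'n) vsymbol"
    using that by (auto simp: count_list_0_iff)
  then have "balanced (?u @ ?v)"
    unfolding balanced_def map_append fst by simp
  then have "uea_of (word (?u @ ?v)) \<in> Virt"
    by (rule balanced_in_Virt)
  moreover have "prod_list (map2 (\<lambda>i \<alpha>. e_gen (Place (Proper i)) \<alpha>) is \<alpha>s)
      * prod_list (map2 (\<lambda>\<alpha> j. e_gen \<alpha> (Place (Proper j))) \<alpha>s js) = uea_of (word (?u @ ?v))"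
    by (simp add: uea_of_word comp_def case_prod_unfold)
  moreover have "acts (?u @ ?v) koszul_ext [] = (-1) ^ (\<Sum>{..<length \<alpha>s}) * koszul (zip (map Proper is) js)"
  proof -
    have "zip (map (\<lambda>i. Place (Proper i)) is) js
        = (map (map_prod Place id) (zip (map Proper is) js) :: (('a, 'b, 'n) vsymbol \<times> 'n) list)"
      by (simp add: zip_map1 comp_def case_prod_unfold)
    then have K: "koszul_ext (zip (map (\<lambda>i. Place (Proper i)) is) js :: (('a, 'b, 'n) vsymbol \<times> 'n) list)
        = koszul (zip (map Proper is) js)"
      by (simp only: koszul_ext_map)
    have "acts (?u @ ?v) koszul_ext [] = acts ?u koszul_ext ([] @ zip \<alpha>s js)"
      unfolding acts_append append_Nil by (rule acts_create) (use assms in auto)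
    also have "\<dots> = (-1) ^ (length is * length ([] :: (('a, 'b, 'n) vsymbol \<times> 'n) list) + \<Sum>{..<length is})
        * koszul_ext ([] @ zip (map (\<lambda>i. Place (Proper i)) is) js :: (('a, 'b, 'n) vsymbol \<times> 'n) list)"
      by (rule acts_annihilate) (use assms in auto)
    finally show ?thesis
      by (simp only: append_Nil K list.size mult_0_right add_0 assms(3))
  qed
  ultimately show ?thesis
    by (simp only: column_capelli_def capelli_proj_eq_devirtualize devirtualize_word)
qed

section \<open>Reordering letters, and superderivations as sums over positions\<close>

lemma swap_invariant_imp_mset_invariant:
  assumes swap: "\<And>u x y v. f (u @ x # y # v) = f (u @ y # x # v)" and "mset xs = mset ys"
  shows "f xs = f ys"
proof -
  have move: "f (t @ u @ x # v) = f (t @ x # u @ v)" for t u x v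
  proof (induction u arbitrary: v rule: rev_induct)
    case (snoc y u)
    then show ?case using swap[of "t @ u" y x v] by simp
  qed simp
  have "f (t @ xs) = f (t @ ys)" for t
    using assms(2)
  proof (induction xs arbitrary: t ys)
    case (Cons x xs)
    then have "x \<in> set ys" by (metis list.set_intros(1) mset_eq_setD)
    then obtain u v where ys: "ys = u @ x # v" by (metis split_list)
    have "f ((t @ [x]) @ xs) = f ((t @ [x]) @ u @ v)"
      using Cons.prems by (intro Cons.IH) (simp add: ys)
    then show ?case by (simp add: ys move)
  qed simp
  from this[of "[]"] show ?thesis by simp
qed

lemma koszul_mset_cong:
  assumes "mset S = mset S'"
  shows "koszul S = koszul S'"
proof (rule swap_invariant_imp_mset_invariant[OF _ assms])
  show "koszul (u @ x # y # v) = koszul (u @ y # x # v)" for u v :: "('a proper \<times> 'a) list" and x y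
    using supersymmetricD[OF supersymmetric_koszul refl, of u x y v] by simp
qed

lemma mset_map_fun_upd:
  assumes "distinct rs" "k \<in> set rs"
  shows "mset (map (f(k := y)) rs) = add_mset y (mset (map f [r\<leftarrow>rs. r \<noteq> k]))"
proof -
  obtain u v where "rs = u @ k # v" using assms(2) by (metis split_list)
  moreover from this have "filter (\<lambda>r. r \<noteq> k) u = u" "filter (\<lambda>r. r \<noteq> k) v = v"
    using assms(1) by (auto simp: filter_id_conv)
  ultimately show ?thesis
    using assms(1) by (simp del: mset_filter)
qed

text \<open>Since the order of the letters is immaterial, the altered letter can be put first, as in
  the left expansion, or last, as in the right one.\<close>

lemma koszul_map_fun_upd:
  assumes "distinct rs" "k \<in> set rs"
  shows "koszul (map (f(k := y)) rs) = koszul (y # map f [r\<leftarrow>rs. r \<noteq> k])"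
    and "koszul (map (f(k := y)) rs) = koszul (map f [r\<leftarrow>rs. r \<noteq> k] @ [y])"
  using mset_map_fun_upd[OF assms, of f y]
  by (auto intro!: koszul_mset_cong simp del: mset_filter koszul.simps)

text \<open>Distinct indices let a changed letter be written as a function update. The letters are
  proper, hence even, so no signs appear.\<close>

lemma der_map_eq_sum:
  fixes f :: "'k \<Rightarrow> 'n proper \<times> 't"
  assumes "distinct rs"
  shows "der (a, b) F (map f rs)
    = (\<Sum>k\<in>set rs. of_bool (fst (f k) = b) * F (map (f(k := (a, snd (f k)))) rs))"
  using assms
proof (induction rs arbitrary: F)
  case (Cons r rs)
  let ?g = "\<lambda>k. f(k := (a, snd (f k)))"
  have r: "distinct rs" "r \<notin> set rs" using Cons.prems by auto
  have "(\<Sum>k\<in>set rs. of_bool (fst (f k) = b) * F (f r # map (?g k) rs))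
    = (\<Sum>k\<in>set rs. of_bool (fst (f k) = b) * F (map (?g k) (r # rs)))"
    using r by (intro sum.cong) auto
  moreover have "(a, snd (f r)) # map f rs = map (?g r) (r # rs)"
    using r by (simp add: map_fun_upd)
  moreover have "der (a, b) F (map f (r # rs)) = of_bool (fst (f r) = b) * F ((a, snd (f r)) # map f rs)
      + der (a, b) (\<lambda>v. F (f r # v)) (map f rs)"
    by simp
  ultimately show ?case
    using Cons.IH[OF r(1), of "\<lambda>v. F (f r # v)"]
    by (simp only: list.set sum.insert[OF finite_set r(2)])
qed simp

section \<open>Right multiplication on the image of the Koszul map\<close>

primrec rder :: "'t \<Rightarrow> 't \<Rightarrow> (('s \<times> 't) list \<Rightarrow> 'r::ring_1) \<Rightarrow> ('s \<times> 't) list \<Rightarrow> 'r" where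
  "rder c d F [] = 0"
| "rder c d F (x # w) = of_bool (snd x = c) * F ((fst x, d) # w) + rder c d (\<lambda>v. F (x # v)) w"

lemma rder_add: "rder c d (\<lambda>v. F v + G v) w = rder c d F w + rder c d G w"
  by (induction w arbitrary: F G) (simp_all add: algebra_simps)

lemma rder_mult_left: "rder c d (\<lambda>v. e * F v) w = e * rder c d F w"
  by (induction w arbitrary: F) (simp_all add: algebra_simps)

lemma rder_map_eq_sum:
  assumes "distinct rs"
  shows "rder c d F (map f rs)
    = (\<Sum>k\<in>set rs. of_bool (snd (f k) = c) * F (map (f(k := (fst (f k), d))) rs))"
  using assms
proof (induction rs arbitrary: F)
  case (Cons r rs)
  let ?g = "\<lambda>k. f(k := (fst (f k), d))"
  have r: "distinct rs" "r \<notin> set rs" using Cons.prems by auto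
  have "(\<Sum>k\<in>set rs. of_bool (snd (f k) = c) * F (f r # map (?g k) rs))
    = (\<Sum>k\<in>set rs. of_bool (snd (f k) = c) * F (map (?g k) (r # rs)))"
    using r by (intro sum.cong) auto
  moreover have "(fst (f r), d) # map f rs = map (?g r) (r # rs)"
    using r by (simp add: map_fun_upd)
  moreover have "rder c d F (map f (r # rs)) = of_bool (snd (f r) = c) * F ((fst (f r), d) # map f rs)
      + rder c d (\<lambda>v. F (f r # v)) (map f rs)"
    by simp
  ultimately show ?case
    using Cons.IH[OF r(1), of "\<lambda>v. F (f r # v)"]
    by (simp only: list.set sum.insert[OF finite_set r(2)])
qed simp

text \<open>One derivation changes the symbols of the letters and the other their places; on proper
  letters no sign arises between them.\<close>

lemma der_rder_commute:
  fixes w :: "('n proper \<times> 't) list"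
  shows "der p (rder c d F) w = rder c d (der p F) w"
proof (induction w arbitrary: F)
  case (Cons x w)
  then show ?case by (simp add: der_add der_mult_left rder_add rder_mult_left)
qed simp

lemma der_snoc:
  fixes w :: "('n proper \<times> 't) list"
  shows "der p F (w @ [x])
    = der p (\<lambda>v. F (v @ [x])) w + of_bool (fst x = snd p) * F (w @ [(fst p, snd x)])"
  by (induction w arbitrary: F) simp_all

text \<open>The mirror image of the recursion of \<open>koszul\<close>. The left recursion is
  applied to both sides, and the commuting of \<open>der\<close> with \<open>rder\<close> makes the
  terms containing both cancel.\<close>

lemma koszul_mult_right:
  "koszul S * E c d = koszul (S @ [(Proper c, d)]) + rder c d koszul S"
proof (induction "length S" arbitrary: S)
  case (Suc n)
  then obtain x S' where S: "S = x # S'" "length S' = n" by (cases S) auto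
  obtain a b where x: "x = (a, b)" by (cases x)
  let ?p = "(a, Proper b)" and ?y = "(Proper c, d)"
  have IH: "koszul v * E c d = koszul (v @ [?y]) + rder c d koszul v" if "length v = n" for v
    using Suc.hyps(1) that by blast
  have E: "e_gen a (Proper b) * koszul v = koszul ((a, b) # v) + der ?p koszul v" for v by simp
  \<comment> \<open>The induction hypothesis may be used under \<open>der\<close>, because all words
    occurring there have the length of \<open>S'\<close>.\<close>
  have "der ?p (\<lambda>v. koszul v * E c d) S' = der ?p (\<lambda>v. koszul (v @ [?y]) + rder c d koszul v) S'"
    by (rule der_cong) (simp_all add: IH S)
  then have 1: "der ?p koszul S' * E c d
      = der ?p (\<lambda>v. koszul (v @ [?y])) S' + rder c d (der ?p koszul) S'"
    by (simp only: der_add der_mult_right der_rder_commute)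
  have 2: "e_gen a (Proper b) * rder c d koszul S'
      = rder c d (\<lambda>v. koszul ((a, b) # v)) S' + rder c d (der ?p koszul) S'"
    by (simp only: E rder_add flip: rder_mult_left)
  have 3: "e_gen a (Proper b) * koszul (S' @ [?y]) = koszul ((a, b) # S' @ [?y])
      + der ?p (\<lambda>v. koszul (v @ [?y])) S'
      + of_bool (Proper c = Proper b) * koszul (S' @ [(a, d)])"
    unfolding E by (simp only: der_snoc fst_conv snd_conv add.assoc)
  \<comment> \<open>The extra term of the preceding equation, where the superderivation hits the
    appended letter, becomes by this reordering the contribution of the first letter to
    \<open>rder\<close>.\<close>
  have 4: "koszul (S' @ [(a, d)]) = koszul ((a, d) # S')"
    by (rule koszul_mset_cong) simp
  have "koszul S * E c d = e_gen a (Proper b) * (koszul S' * E c d) - der ?p koszul S' * E c d"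
    by (simp add: S x algebra_simps)
  also have "\<dots> = koszul ((a, b) # S' @ [?y]) + (of_bool (Proper c = Proper b) * koszul ((a, d) # S')
      + rder c d (\<lambda>v. koszul ((a, b) # v)) S')"
    unfolding IH[OF S(2)] distrib_left 1 2 3 4 by (simp only: algebra_simps)
  also have "\<dots> = koszul (S @ [?y]) + rder c d koszul S"
    unfolding S x by (simp only: append_Cons rder.simps fst_conv snd_conv proper.inject eq_commute)
  finally show ?case .
qed (simp add: e_gen_def)

lemma sum_lessThan_Suc_sign:
  "(-1) ^ (\<Sum>{..<Suc n}) = (-1) ^ n * ((-1) ^ (\<Sum>{..<n}) :: 'r::ring_1)"
  by (simp add: lessThan_Suc power_add)

section \<open>The left and right expansions of a column Capelli bitableau\<close>

theorem proposition4p7: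
  fixes i j :: "nat \<Rightarrow> 'n::finite"
    and h :: nat
    and \<alpha>s \<beta>s :: "('a::finite, 'b::finite, 'n) vsymbol list"
  assumes "h \<ge> 2"
    and "distinct \<alpha>s" "set \<alpha>s \<subseteq> range Alpha" "length \<alpha>s = h"
    and "distinct \<beta>s" "set \<beta>s \<subseteq> range Alpha" "length \<beta>s = h - 1"
  shows "column_capelli \<alpha>s (map i [1..<h + 1]) (map j [1..<h + 1]) =
      (-1) ^ (h - 1) * E (i 1) (j 1) *
        column_capelli \<beta>s (map i [2..<h + 1]) (map j [2..<h + 1]) +
      (-1) ^ (h - 2) * (\<Sum>k = 2..h. of_bool (i k = j 1) *
        column_capelli \<beta>s
          (map i (1 # [r \<leftarrow> [2..<h + 1]. r \<noteq> k]))
          (map j (k # [r \<leftarrow> [2..<h + 1]. r \<noteq> k])))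
    \<and> column_capelli \<alpha>s (map i [1..<h + 1]) (map j [1..<h + 1]) =
      (-1) ^ (h - 1) * column_capelli \<beta>s (map i [1..<h]) (map j [1..<h]) * E (i h) (j h) +
      (-1) ^ (h - 2) * (\<Sum>k = 1..h - 1. of_bool (i h = j k) *
        column_capelli \<beta>s
          (map i ([r \<leftarrow> [1..<h]. r \<noteq> k] @ [k]))
          (map j ([r \<leftarrow> [1..<h]. r \<noteq> k] @ [h])))"
proof -
  obtain m where "h = 2 + m" using le_Suc_ex[OF assms(1)] by blast
  then have h: "h = Suc (Suc m)" by simp
  let ?f = "\<lambda>r. (Proper (i r), j r)"
  \<comment> \<open>Columns of height \<open>h - 1\<close> carry the sign \<open>s\<close>. For
    height \<open>h\<close> the sign is \<open>(-1) ^ (h - 1) * s\<close>, that is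
    \<open>- t * s\<close>; the quotient \<open>- t\<close> is the leading sign in both
    expansions.\<close>
  define s :: "'n proper uea" where "s = (-1) ^ (\<Sum>{..<h - 1})"
  define t :: "'n proper uea" where "t = (-1) ^ m"
  have st: "s = 1 \<or> s = -1" "t = 1 \<or> t = -1" unfolding s_def t_def by (rule sign_cases)+
  have \<alpha>: "column_capelli \<alpha>s (map i rs) (map j rs) = - (t * (s * koszul (map ?f rs)))"
    if "length rs = h" for rs
    using that assms sum_lessThan_Suc_sign[of "Suc m", where 'r = "'n proper uea"]
    by (simp add: column_capelli_eq_koszul h s_def t_def zip_map_map zip_same_conv_map comp_def
        mult.assoc del: sum.lessThan_Suc)
  have \<beta>: "column_capelli \<beta>s is js = s * koszul (zip (map Proper is) js)"
    if "length is = h - 1" "length js = h - 1" for "is" js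
    using that assms by (simp add: column_capelli_eq_koszul s_def)
  have zip_f: "zip (map Proper (map i rs)) (map j rs) = map ?f rs" for rs
    by (simp add: zip_map_map zip_same_conv_map comp_def)
  \<comment> \<open>The length is read off as the size of the multiset obtained from a constant map
    into the unit type.\<close>
  have len: "length [r\<leftarrow>rs. r \<noteq> k] = length rs - 1" if "distinct rs" "k \<in> set rs" for rs and k :: nat
    using arg_cong[OF mset_map_fun_upd[OF that, of "\<lambda>_. ()" "()"], of size]
    by (simp del: mset_filter)
  have signs: "(-1) ^ (h - 1) = - t" "(-1) ^ (h - 2) = t" by (simp_all add: h t_def)
  have "koszul (map ?f [1..<h + 1]) = E (i 1) (j 1) * koszul (map ?f [2..<h + 1])
      - der (Proper (i 1), Proper (j 1)) koszul (map ?f [2..<h + 1])"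
  proof -
    have "[1..<h + 1] = 1 # [2..<h + 1]"
      using assms(1) by (subst upt_conv_Cons) (simp_all add: numeral_2_eq_2 del: upt_Suc)
    then show ?thesis by (simp only: list.map koszul.simps fst_conv snd_conv)
  qed
  also have "der (Proper (i 1), Proper (j 1)) koszul (map ?f [2..<h + 1])
      = (\<Sum>k = 2..h. of_bool (i k = j 1) * koszul ((Proper (i 1), j k) # map ?f [r\<leftarrow>[2..<h + 1]. r \<noteq> k]))"
    unfolding der_map_eq_sum[OF distinct_upt]
  proof (intro sum.cong)
    fix k assume "k \<in> {2..h}"
    then have "koszul (map (?f(k := (Proper (i 1), j k))) [2..<h + 1])
        = koszul ((Proper (i 1), j k) # map ?f [r\<leftarrow>[2..<h + 1]. r \<noteq> k])"
      by (intro koszul_map_fun_upd(1)) auto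
    then show "of_bool (fst (?f k) = Proper (j 1)) * koszul (map (?f(k := (Proper (i 1), snd (?f k)))) [2..<h + 1])
      = of_bool (i k = j 1) * koszul ((Proper (i 1), j k) # map ?f [r\<leftarrow>[2..<h + 1]. r \<noteq> k])"
      by (simp only: fst_conv snd_conv proper.inject)
  qed auto
  finally have left: "koszul (map ?f [1..<h + 1]) = E (i 1) (j 1) * koszul (map ?f [2..<h + 1])
      - (\<Sum>k = 2..h. of_bool (i k = j 1) * koszul ((Proper (i 1), j k) # map ?f [r\<leftarrow>[2..<h + 1]. r \<noteq> k]))" .
  have left_summand: "column_capelli \<beta>s (map i (1 # [r \<leftarrow> [2..<h + 1]. r \<noteq> k])) (map j (k # [r \<leftarrow> [2..<h + 1]. r \<noteq> k]))
      = s * koszul ((Proper (i 1), j k) # map ?f [r\<leftarrow>[2..<h + 1]. r \<noteq> k])" if "k \<in> {2..h}" for k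
  proof -
    have "length [r\<leftarrow>[2..<h + 1]. r \<noteq> k] = h - 2"
      using len[of "[2..<h + 1]" k] that by auto
    then show ?thesis
      by (subst \<beta>) (simp_all add: h zip_f[simplified] del: upt_Suc)
  qed
  have left_rest: "column_capelli \<beta>s (map i [2..<h + 1]) (map j [2..<h + 1])
      = s * koszul (map ?f [2..<h + 1])"
    by (subst \<beta>) (simp_all add: zip_f[simplified] del: upt_Suc)
  \<comment> \<open>For the right expansion \<open>koszul_mult_right\<close> takes the place of the
    defining recursion.\<close>
  have "koszul (map ?f [1..<h + 1]) = koszul (map ?f [1..<h]) * E (i h) (j h)
      - rder (i h) (j h) koszul (map ?f [1..<h])"
    using koszul_mult_right[of "map ?f [1..<h]" "i h" "j h"] by (simp add: h)
  also have "rder (i h) (j h) koszul (map ?f [1..<h])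
      = (\<Sum>k = 1..h - 1. of_bool (i h = j k) * koszul (map ?f [r\<leftarrow>[1..<h]. r \<noteq> k] @ [(Proper (i k), j h)]))"
    unfolding rder_map_eq_sum[OF distinct_upt]
  proof (intro sum.cong)
    fix k assume "k \<in> {1..h - 1}"
    then have "koszul (map (?f(k := (Proper (i k), j h))) [1..<h])
        = koszul (map ?f [r\<leftarrow>[1..<h]. r \<noteq> k] @ [(Proper (i k), j h)])"
      by (intro koszul_map_fun_upd(2)) auto
    then show "of_bool (snd (?f k) = i h) * koszul (map (?f(k := (fst (?f k), j h))) [1..<h])
      = of_bool (i h = j k) * koszul (map ?f [r\<leftarrow>[1..<h]. r \<noteq> k] @ [(Proper (i k), j h)])"
      by (simp only: fst_conv snd_conv eq_commute[of "i h"])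
  qed auto
  finally have right: "koszul (map ?f [1..<h + 1]) = koszul (map ?f [1..<h]) * E (i h) (j h)
      - (\<Sum>k = 1..h - 1. of_bool (i h = j k) * koszul (map ?f [r\<leftarrow>[1..<h]. r \<noteq> k] @ [(Proper (i k), j h)]))" .
  have right_summand: "column_capelli \<beta>s (map i ([r \<leftarrow> [1..<h]. r \<noteq> k] @ [k])) (map j ([r \<leftarrow> [1..<h]. r \<noteq> k] @ [h]))
      = s * koszul (map ?f [r\<leftarrow>[1..<h]. r \<noteq> k] @ [(Proper (i k), j h)])" if "k \<in> {1..h - 1}" for k
  proof -
    have "length [r\<leftarrow>[1..<h]. r \<noteq> k] = h - 2"
      using len[of "[1..<h]" k] that by auto
    then show ?thesis
      by (subst \<beta>) (simp_all add: h zip_f[simplified] del: upt_Suc)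
  qed
  have right_rest: "column_capelli \<beta>s (map i [1..<h]) (map j [1..<h]) = s * koszul (map ?f [1..<h])"
    by (subst \<beta>) (simp_all add: zip_f[simplified] del: upt_Suc)
  have column: "column_capelli \<alpha>s (map i [1..<h + 1]) (map j [1..<h + 1]) = - (t * (s * koszul (map ?f [1..<h + 1])))"
    by (rule \<alpha>) simp
  \<comment> \<open>Being 1 or -1, the signs commute with everything, so \<open>s\<close> can be
    moved into each bitableau of height \<open>h - 1\<close>.\<close>
  have distrib: "- (t * (s * (x * y - (\<Sum>k\<in>A. of_bool (P k) * z k))))
    = - t * x * (s * y) + t * (\<Sum>k\<in>A. of_bool (P k) * (s * z k))"
    "- (t * (s * (y * x - (\<Sum>k\<in>A. of_bool (P k) * z k))))
    = - t * (s * y) * x + t * (\<Sum>k\<in>A. of_bool (P k) * (s * z k))"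
    for x y :: "'n proper uea" and P z and A :: "nat set"
    using st by (elim disjE; simp add: sum_negf)+
  show ?thesis
  proof
    show "column_capelli \<alpha>s (map i [1..<h + 1]) (map j [1..<h + 1]) =
      (-1) ^ (h - 1) * E (i 1) (j 1) *
        column_capelli \<beta>s (map i [2..<h + 1]) (map j [2..<h + 1]) +
      (-1) ^ (h - 2) * (\<Sum>k = 2..h. of_bool (i k = j 1) *
        column_capelli \<beta>s
          (map i (1 # [r \<leftarrow> [2..<h + 1]. r \<noteq> k]))
          (map j (k # [r \<leftarrow> [2..<h + 1]. r \<noteq> k])))"
      by (simp only: column left distrib(1) signs left_rest left_summand cong: sum.cong)
    show "column_capelli \<alpha>s (map i [1..<h + 1]) (map j [1..<h + 1]) =
      (-1) ^ (h - 1) * column_capelli \<beta>s (map i [1..<h]) (map j [1..<h]) * E (i h) (j h) +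
      (-1) ^ (h - 2) * (\<Sum>k = 1..h - 1. of_bool (i h = j k) *
        column_capelli \<beta>s
          (map i ([r \<leftarrow> [1..<h]. r \<noteq> k] @ [k]))
          (map j ([r \<leftarrow> [1..<h]. r \<noteq> k] @ [h])))"
      by (simp only: column right distrib(2) signs right_rest right_summand cong: sum.cong)
  qed
qed

end
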